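(* Let $\psi\colon X\to Y$ be an integral homology equivalence of spaces such that the induced homomorphism $f=\pi_1\psi\colon\pi_1X\to\pi_1Y$ is an epimorphism. Then $\ker f\subset\Gamma\pi_1X$.
   Context: Spaces are connected and have the homotopy type of CW-complexes. A normal subgroup $H$ of a group $G$ is called $G$-perfect if $H=[H,G]$. Every group $G$ has a maximal $G$-perfect normal subgroup, denoted $\Gamma G$ (it equals the intersection of the transfinite lower central series of $G$). An integral homology equivalence is a map inducing isomorphisms on all integral homology groups. *)

theory Defs
  imports "HOL-Homology.Homology"
begin

subsection \<open>Relatively perfect normal subgroups\<close>

definition mixed_commutator :: "('a, 'b) monoid_scheme \<Rightarrow> 'a set \<Rightarrow> 'a set \<Rightarrow> 'a set" where
  "mixed_commutator G H K =
     generate G (\<Union>h\<in>H. \<Union>k\<in>K. {h \<otimes>\<^bsub>G\<^esub> k \<otimes>\<^bsub>G\<^esub> inv\<^bsub>G\<^esub> h \<otimes>\<^bsub>G\<^esub> inv\<^bsub>G\<^esub> k})"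

definition relatively_perfect :: "('a, 'b) monoid_scheme \<Rightarrow> 'a set \<Rightarrow> bool" where
  "relatively_perfect G H \<longleftrightarrow> H \<lhd> G \<and> H = mixed_commutator G H (carrier G)"

text \<open>The order on sets is inclusion; the greatest element exists for every group, see
  \<open>Gamma_greatest\<close> below.\<close>

definition Gamma :: "('a, 'b) monoid_scheme \<Rightarrow> 'a set" where
  "Gamma G = (GREATEST H. relatively_perfect G H)"

lemma (in group) mixed_commutator_subgroup:
  assumes "H \<subseteq> carrier G"
  shows "subgroup (mixed_commutator G H (carrier G)) G"
  unfolding mixed_commutator_def
  by (rule generate_is_subgroup) (use assms in blast)

lemma (in group) mixed_commutator_mono:
  assumes "H \<subseteq> K"
  shows "mixed_commutator G H (carrier G) \<subseteq> mixed_commutator G K (carrier G)"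
  unfolding mixed_commutator_def by (rule mono_generate) (use assms in blast)

lemma (in group) mixed_commutator_normal_subset:
  assumes "H \<lhd> G"
  shows "mixed_commutator G H (carrier G) \<subseteq> H"
proof -
  interpret normal H G by fact
  have "h \<otimes> g \<otimes> inv h \<otimes> inv g \<in> H" if "h \<in> H" "g \<in> carrier G" for h g
  proof -
    have "g \<otimes> inv h \<otimes> inv g \<in> H" using that by (simp add: inv_op_closed2)
    moreover have "h \<otimes> g \<otimes> inv h \<otimes> inv g = h \<otimes> (g \<otimes> inv h \<otimes> inv g)"
      using that by (simp add: m_assoc)
    ultimately show ?thesis using that by simp
  qed
  then show ?thesis
    unfolding mixed_commutator_def
    by (intro generate_subgroup_incl) (use subgroup_axioms in blast)+
qed

lemma (in group) Gamma_greatest: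
  shows "relatively_perfect G (Gamma G)"
    and "relatively_perfect G H \<Longrightarrow> H \<subseteq> Gamma G"
proof -
  define U where "U = \<Union>{H. relatively_perfect G H}"
  define M where "M = generate G U"
  have nor: "H \<lhd> G" if "relatively_perfect G H" for H
    using that by (simp add: relatively_perfect_def)
  have Uc: "U \<subseteq> carrier G"
    unfolding U_def using nor normal_imp_subgroup subgroup.subset by blast
  have UM: "U \<subseteq> M" unfolding M_def by (auto intro: generate.incl)
  have "g \<otimes> h \<otimes> inv g \<in> U" if "h \<in> U" "g \<in> carrier G" for h g
    using that nor normal.inv_op_closed2 unfolding U_def by fastforce
  then have Mn: "M \<lhd> G" unfolding M_def using Uc by (intro normal_generateI)
  have Mc: "M \<subseteq> carrier G" using Mn normal_imp_subgroup subgroup.subset by blast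
  have "U \<subseteq> mixed_commutator G M (carrier G)"
  proof
    fix x assume "x \<in> U"
    then obtain H where H: "relatively_perfect G H" "x \<in> H" unfolding U_def by blast
    then have "x \<in> mixed_commutator G H (carrier G)" by (auto simp: relatively_perfect_def)
    moreover have "H \<subseteq> M" using H(1) UM unfolding U_def by blast
    ultimately show "x \<in> mixed_commutator G M (carrier G)"
      using mixed_commutator_mono by blast
  qed
  then have "M \<subseteq> mixed_commutator G M (carrier G)"
    unfolding M_def by (intro generate_subgroup_incl)
      (use mixed_commutator_subgroup[OF Mc] M_def in auto)
  with Mn have MP: "relatively_perfect G M"
    using mixed_commutator_normal_subset by (auto simp: relatively_perfect_def)
  have Mmax: "H \<subseteq> M" if "relatively_perfect G H" for H
    using that UM unfolding U_def by blast
  have "Gamma G = M"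
    unfolding Gamma_def by (rule Greatest_equality) (use MP Mmax in auto)
  then show "relatively_perfect G (Gamma G)" "relatively_perfect G H \<Longrightarrow> H \<subseteq> Gamma G"
    using MP Mmax by auto
qed


subsection \<open>The fundamental group of a topology\<close>

text \<open>The library's \<open>joinpaths\<close> and \<open>homotopic_paths\<close> are only available for types carrying a
  canonical topology, so their analogues for an explicit \<open>'a topology\<close> are used here.\<close>

definition loop_at :: "'a topology \<Rightarrow> 'a \<Rightarrow> (real \<Rightarrow> 'a) \<Rightarrow> bool" where
  "loop_at X x g \<longleftrightarrow> pathin X g \<and> g 0 = x \<and> g 1 = x"

definition concat_loops :: "(real \<Rightarrow> 'a) \<Rightarrow> (real \<Rightarrow> 'a) \<Rightarrow> real \<Rightarrow> 'a" where
  "concat_loops f g = (\<lambda>t. if t \<le> 1/2 then f (2 * t) else g (2 * t - 1))"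

definition homotopic_loops_at :: "'a topology \<Rightarrow> 'a \<Rightarrow> (real \<Rightarrow> 'a) \<Rightarrow> (real \<Rightarrow> 'a) \<Rightarrow> bool" where
  "homotopic_loops_at X x =
     homotopic_with (\<lambda>r. r 0 = x \<and> r 1 = x) (top_of_set {0..1::real}) X"

definition loop_class :: "'a topology \<Rightarrow> 'a \<Rightarrow> (real \<Rightarrow> 'a) \<Rightarrow> (real \<Rightarrow> 'a) set" where
  "loop_class X x f = {g. homotopic_loops_at X x f g}"

definition fundamental_group :: "'a topology \<Rightarrow> 'a \<Rightarrow> (real \<Rightarrow> 'a) set monoid" where
  "fundamental_group X x =
     \<lparr> carrier = {loop_class X x f |f. loop_at X x f},
       mult = (\<lambda>A B. \<Union>f\<in>A. \<Union>g\<in>B. loop_class X x (concat_loops f g)),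
       one = loop_class X x (\<lambda>_. x) \<rparr>"

text \<open>The homomorphism \<open>\<pi>\<^sub>1(X, x) \<rightarrow> \<pi>\<^sub>1(Y, \<psi> x)\<close> sending the class of \<open>f\<close> to the class of
  \<open>\<psi> \<circ> f\<close>.\<close>

definition fundamental_group_map ::
    "'a \<Rightarrow> 'b topology \<Rightarrow> ('a \<Rightarrow> 'b) \<Rightarrow> (real \<Rightarrow> 'a) set \<Rightarrow> (real \<Rightarrow> 'b) set" where
  "fundamental_group_map x Y \<psi> A = (\<Union>f\<in>A. loop_class Y (\<psi> x) (\<psi> \<circ> f))"


lemma homotopic_loops_at_iff:
  "homotopic_loops_at X x f g \<longleftrightarrow>
     (\<exists>h. continuous_map (prod_topology (top_of_set {0..1::real}) (top_of_set {0..1::real})) X h \<and>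
        (\<forall>t\<in>{0..1}. h (0, t) = f t) \<and> (\<forall>t\<in>{0..1}. h (1, t) = g t) \<and>
        (\<forall>s\<in>{0..1}. h (s, 0) = x \<and> h (s, 1) = x))"
  unfolding homotopic_loops_at_def by (subst homotopic_with) auto

lemma homotopic_loops_at_imp_loops:
  assumes "homotopic_loops_at X x f g"
  shows "loop_at X x f" "loop_at X x g"
  using homotopic_with_imp_continuous_maps[OF assms[unfolded homotopic_loops_at_def]]
    homotopic_with_imp_property[OF assms[unfolded homotopic_loops_at_def]]
  by (auto simp: loop_at_def pathin_def)

lemma homotopic_loops_at_refl: "homotopic_loops_at X x f f \<longleftrightarrow> loop_at X x f"
  by (auto simp: homotopic_loops_at_def loop_at_def pathin_def homotopic_with_refl)

lemma homotopic_loops_at_sym: "homotopic_loops_at X x f g \<Longrightarrow> homotopic_loops_at X x g f"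
  unfolding homotopic_loops_at_def by (simp add: homotopic_with_symD)

lemma homotopic_loops_at_trans:
  "homotopic_loops_at X x f g \<Longrightarrow> homotopic_loops_at X x g h \<Longrightarrow> homotopic_loops_at X x f h"
  unfolding homotopic_loops_at_def by (rule homotopic_with_trans)

lemma loop_class_eq_iff:
  assumes "loop_at X x f"
  shows "loop_class X x f = loop_class X x g \<longleftrightarrow> homotopic_loops_at X x f g"
proof
  assume "loop_class X x f = loop_class X x g"
  moreover have "f \<in> loop_class X x f" using assms by (simp add: loop_class_def homotopic_loops_at_refl)
  ultimately show "homotopic_loops_at X x f g" by (simp add: loop_class_def homotopic_loops_at_sym)
next
  assume "homotopic_loops_at X x f g"
  then show "loop_class X x f = loop_class X x g"
    unfolding loop_class_def by (blast intro: homotopic_loops_at_sym homotopic_loops_at_trans)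
qed

lemma homotopic_loops_at_concat:
  assumes "homotopic_loops_at X x f f'" "homotopic_loops_at X x g g'"
  shows "homotopic_loops_at X x (concat_loops f g) (concat_loops f' g')"
proof -
  let ?I = "top_of_set {0..1::real}"
  let ?II = "prod_topology ?I ?I"
  obtain h where h: "continuous_map ?II X h" "\<forall>t\<in>{0..1}. h (0, t) = f t" "\<forall>t\<in>{0..1}. h (1, t) = f' t"
      "\<forall>s\<in>{0..1}. h (s, 0) = x \<and> h (s, 1) = x"
    using assms(1) unfolding homotopic_loops_at_iff by blast
  obtain k where k: "continuous_map ?II X k" "\<forall>t\<in>{0..1}. k (0, t) = g t" "\<forall>t\<in>{0..1}. k (1, t) = g' t"
      "\<forall>s\<in>{0..1}. k (s, 0) = x \<and> k (s, 1) = x"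
    using assms(2) unfolding homotopic_loops_at_iff by blast
  define H where "H = (\<lambda>p::real\<times>real. if snd p \<le> 1/2 then h (fst p, 2 * snd p) else k (fst p, 2 * snd p - 1))"
  have top: "?II = top_of_set ({0..1} \<times> {0..1})" by (simp add: subtopology_Times)
  have "continuous_map ?II X H"
    unfolding H_def
  proof (rule continuous_map_cases_le)
    show "continuous_map ?II euclideanreal snd"
      by (simp add: top continuous_on_snd)
    show "continuous_map ?II euclideanreal (\<lambda>p. 1/2)" by simp
    have "continuous_map (subtopology ?II {p \<in> topspace ?II. snd p \<le> 1/2}) ?II (\<lambda>p. (fst p, 2 * snd p))"
      unfolding top subtopology_subtopology
      by (auto intro!: continuous_intros simp: continuous_map_in_subtopology)
    from continuous_map_compose[OF this h(1)]
    show "continuous_map (subtopology ?II {p \<in> topspace ?II. snd p \<le> 1/2}) X (\<lambda>p. h (fst p, 2 * snd p))"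
      by (simp add: o_def)
    have "continuous_map (subtopology ?II {p \<in> topspace ?II. 1/2 \<le> snd p}) ?II (\<lambda>p. (fst p, 2 * snd p - 1))"
      unfolding top subtopology_subtopology
      by (auto intro!: continuous_intros simp: continuous_map_in_subtopology)
    from continuous_map_compose[OF this k(1)]
    show "continuous_map (subtopology ?II {p \<in> topspace ?II. 1/2 \<le> snd p}) X (\<lambda>p. k (fst p, 2 * snd p - 1))"
      by (simp add: o_def)
  next
    fix p assume "p \<in> topspace ?II" and p: "snd p = 1/2"
    then have "fst p \<in> {0..1}" by auto
    then show "h (fst p, 2 * snd p) = k (fst p, 2 * snd p - 1)" using h(4) k(4) by (simp add: p)
  qed
  then show ?thesis
    unfolding homotopic_loops_at_iff
    by (intro exI[of _ H]) (use h k in \<open>auto simp: H_def concat_loops_def\<close>)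
qed

lemma loop_at_concat: "loop_at X x f \<Longrightarrow> loop_at X x g \<Longrightarrow> loop_at X x (concat_loops f g)"
  using homotopic_loops_at_concat[of X x f f g g] by (simp add: homotopic_loops_at_refl)

lemma homotopic_loops_at_reparam:
  assumes f: "pathin X f"
    and \<alpha>: "continuous_on {0..1} \<alpha>" "\<And>t. t \<in> {0..1} \<Longrightarrow> \<alpha> t \<in> {0..1::real}"
    and \<beta>: "continuous_on {0..1} \<beta>" "\<And>t. t \<in> {0..1} \<Longrightarrow> \<beta> t \<in> {0..1::real}"
    and ends: "\<alpha> 0 = \<beta> 0" "\<alpha> 1 = \<beta> 1" "f (\<beta> 0) = x" "f (\<beta> 1) = x"
    and p: "\<And>t. t \<in> {0..1} \<Longrightarrow> p t = f (\<alpha> t)" and q: "\<And>t. t \<in> {0..1} \<Longrightarrow> q t = f (\<beta> t)"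
  shows "homotopic_loops_at X x p q"
proof -
  let ?I = "top_of_set {0..1::real}"
  let ?II = "prod_topology ?I ?I"
  define r where "r = (\<lambda>(s, t). (1 - s) * \<alpha> t + s * \<beta> t)"
  have r01: "r (s, t) \<in> {0..1}" if "s \<in> {0..1}" "t \<in> {0..1}" for s t
    using convexD_alt[OF convex_real_interval(5)[of 0 1] \<alpha>(2)[OF that(2)] \<beta>(2)[OF that(2)], of s] that(1)
    by (auto simp: r_def)
  have "continuous_on ({0..1} \<times> {0..1}) (\<lambda>p. \<alpha> (snd p))" "continuous_on ({0..1} \<times> {0..1}) (\<lambda>p. \<beta> (snd p))"
    by (auto intro!: continuous_on_compose2[OF \<alpha>(1)] continuous_on_compose2[OF \<beta>(1)] continuous_intros)
  then have "continuous_on ({0..1} \<times> {0..1}) r"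
    unfolding r_def case_prod_beta by (intro continuous_intros)
  then have "continuous_map ?II ?I r"
    using r01 by (auto simp: subtopology_Times[symmetric] continuous_map_in_subtopology)
  from continuous_map_compose[OF this f[unfolded pathin_def]]
  have "continuous_map ?II X (f \<circ> r)" .
  then show ?thesis
    unfolding homotopic_loops_at_iff
    by (intro exI[of _ "f \<circ> r"]) (use ends p q in \<open>auto simp: r_def algebra_simps\<close>)
qed

lemma mult_fundamental_group:
  assumes "loop_at X x f" "loop_at X x g"
  shows "loop_class X x f \<otimes>\<^bsub>fundamental_group X x\<^esub> loop_class X x g
       = loop_class X x (concat_loops f g)"
proof -
  have "loop_class X x (concat_loops f' g') = loop_class X x (concat_loops f g)"
    if "f' \<in> loop_class X x f" "g' \<in> loop_class X x g" for f' g'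
    using that homotopic_loops_at_concat[of X x f f' g g'] loop_class_eq_iff loop_at_concat[OF assms]
    by (fastforce simp: loop_class_def)
  moreover have "f \<in> loop_class X x f" "g \<in> loop_class X x g"
    using assms by (auto simp: loop_class_def homotopic_loops_at_refl)
  ultimately have "(\<Union>f'\<in>loop_class X x f. \<Union>g'\<in>loop_class X x g. loop_class X x (concat_loops f' g'))
      = loop_class X x (concat_loops f g)" by blast
  then show ?thesis by (simp add: fundamental_group_def)
qed

lemma group_fundamental_group:
  assumes "x \<in> topspace X"
  shows "group (fundamental_group X x)"
proof -
  let ?G = "fundamental_group X x"
  have c: "loop_at X x (\<lambda>_. x)" using assms by (simp add: loop_at_def pathin_def)
  have carr: "A \<in> carrier ?G \<longleftrightarrow> (\<exists>f. loop_at X x f \<and> A = loop_class X x f)" for A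
    by (auto simp: fundamental_group_def)
  have one: "\<one>\<^bsub>?G\<^esub> = loop_class X x (\<lambda>_. x)" by (simp add: fundamental_group_def)
  show ?thesis
  proof (rule groupI)
    fix A B assume "A \<in> carrier ?G" "B \<in> carrier ?G"
    then show "A \<otimes>\<^bsub>?G\<^esub> B \<in> carrier ?G"
      using mult_fundamental_group loop_at_concat unfolding carr by metis
  next
    show "\<one>\<^bsub>?G\<^esub> \<in> carrier ?G" using c unfolding carr one by blast
  next
    fix A B C assume "A \<in> carrier ?G" "B \<in> carrier ?G" "C \<in> carrier ?G"
    then obtain f g h where fgh: "loop_at X x f" "loop_at X x g" "loop_at X x h"
      "A = loop_class X x f" "B = loop_class X x g" "C = loop_class X x h" unfolding carr by blast
    have l: "loop_at X x (concat_loops f (concat_loops g h))" by (intro loop_at_concat fgh)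
    define \<alpha> :: "real \<Rightarrow> real" where
      "\<alpha> = (\<lambda>t. if t \<le> 1/2 then (if t \<le> 1/4 then 2 * t else t + 1/4) else t / 2 + 1/2)"
    have "continuous_on {0..1} (\<lambda>t::real. if t \<le> 1/4 then 2 * t else t + 1/4)"
      by (intro continuous_on_cases_le continuous_intros) auto
    then have \<alpha>: "continuous_on {0..1} \<alpha>"
      unfolding \<alpha>_def by (intro continuous_on_cases_le continuous_intros continuous_on_subset[of "{0..1}"]) auto
    have "homotopic_loops_at X x (concat_loops (concat_loops f g) h) (concat_loops f (concat_loops g h))"
      by (rule homotopic_loops_at_reparam[of X "concat_loops f (concat_loops g h)" \<alpha> "\<lambda>t. t"])
         (use l \<alpha> in \<open>auto simp: \<alpha>_def loop_at_def concat_loops_def algebra_simps\<close>)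
    then show "A \<otimes>\<^bsub>?G\<^esub> B \<otimes>\<^bsub>?G\<^esub> C = A \<otimes>\<^bsub>?G\<^esub> (B \<otimes>\<^bsub>?G\<^esub> C)"
      using fgh by (simp add: mult_fundamental_group loop_at_concat loop_class_eq_iff)
  next
    fix A assume "A \<in> carrier ?G"
    then obtain f where f: "loop_at X x f" "A = loop_class X x f" unfolding carr by blast
    have m: "continuous_on {0..1} (\<lambda>t::real. max 0 (2 * t - 1))" by (intro continuous_intros)
    have "homotopic_loops_at X x (concat_loops (\<lambda>_. x) f) f"
      by (rule homotopic_loops_at_reparam[of X f "\<lambda>t. max 0 (2 * t - 1)" "\<lambda>t. t"])
         (use f m in \<open>auto simp: loop_at_def concat_loops_def max_absorb1 max_absorb2\<close>)
    then show "\<one>\<^bsub>?G\<^esub> \<otimes>\<^bsub>?G\<^esub> A = A"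
      using f c one by (simp add: mult_fundamental_group loop_at_concat loop_class_eq_iff)
    have r: "homotopic_loops_at X x (\<lambda>t. f (1 - t)) (\<lambda>t. f (1 - t))"
      by (rule homotopic_loops_at_reparam[of X f "\<lambda>t. 1 - t" "\<lambda>t. 1 - t"])
         (use f in \<open>auto simp: loop_at_def intro!: continuous_intros\<close>)
    have m: "continuous_on {0..1} (\<lambda>t::real. \<bar>1 - 2 * t\<bar>)" by (intro continuous_intros)
    have "homotopic_loops_at X x (concat_loops (\<lambda>t. f (1 - t)) f) (\<lambda>_. x)"
      by (rule homotopic_loops_at_reparam[of X f "\<lambda>t. \<bar>1 - 2 * t\<bar>" "\<lambda>t. 1"])
         (use f m in \<open>auto simp: loop_at_def concat_loops_def abs_if\<close>)
    then have "loop_class X x (\<lambda>t. f (1 - t)) \<otimes>\<^bsub>?G\<^esub> A = \<one>\<^bsub>?G\<^esub>"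
      using f r one by (simp add: mult_fundamental_group loop_at_concat loop_class_eq_iff homotopic_loops_at_refl)
    moreover have "loop_class X x (\<lambda>t. f (1 - t)) \<in> carrier ?G"
      using r by (auto simp: carr homotopic_loops_at_refl)
    ultimately show "\<exists>B\<in>carrier ?G. B \<otimes>\<^bsub>?G\<^esub> A = \<one>\<^bsub>?G\<^esub>"
      by (rule bexI)
  qed
qed

lemma fundamental_group_map_loop_class:
  assumes "continuous_map X Y \<psi>" "loop_at X x f"
  shows "fundamental_group_map x Y \<psi> (loop_class X x f) = loop_class Y (\<psi> x) (\<psi> \<circ> f)"
proof -
  have hom: "homotopic_loops_at Y (\<psi> x) (\<psi> \<circ> f) (\<psi> \<circ> g)" if "homotopic_loops_at X x f g" for g
    using that unfolding homotopic_loops_at_def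
    by (rule homotopic_with_compose_continuous_map_left) (use assms in auto)
  have "loop_class Y (\<psi> x) (\<psi> \<circ> g) = loop_class Y (\<psi> x) (\<psi> \<circ> f)" if "g \<in> loop_class X x f" for g
  proof -
    have h: "homotopic_loops_at Y (\<psi> x) (\<psi> \<circ> f) (\<psi> \<circ> g)"
      using hom that by (simp add: loop_class_def)
    then show ?thesis
      using loop_class_eq_iff[OF homotopic_loops_at_imp_loops(1)[OF h]] by metis
  qed
  moreover have "f \<in> loop_class X x f"
    using assms by (auto simp: loop_class_def homotopic_loops_at_refl)
  ultimately show ?thesis unfolding fundamental_group_map_def by blast
qed

lemma fundamental_group_map_hom:
  assumes "continuous_map X Y \<psi>"
  shows "fundamental_group_map x Y \<psi> \<in> hom (fundamental_group X x) (fundamental_group Y (\<psi> x))"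
proof -
  have l: "loop_at Y (\<psi> x) (\<psi> \<circ> f)" if "loop_at X x f" for f
    using that pathin_compose[OF _ assms] by (auto simp: loop_at_def)
  have "\<psi> \<circ> concat_loops f g = concat_loops (\<psi> \<circ> f) (\<psi> \<circ> g)" for f g
    by (auto simp: concat_loops_def)
  then have m: "fundamental_group_map x Y \<psi> (loop_class X x f \<otimes>\<^bsub>fundamental_group X x\<^esub> loop_class X x g)
      = fundamental_group_map x Y \<psi> (loop_class X x f) \<otimes>\<^bsub>fundamental_group Y (\<psi> x)\<^esub>
        fundamental_group_map x Y \<psi> (loop_class X x g)"
    if "loop_at X x f" "loop_at X x g" for f g
    using that l
    by (simp add: mult_fundamental_group fundamental_group_map_loop_class[OF assms] loop_at_concat)
  have carr: "A \<in> carrier (fundamental_group Z z) \<longleftrightarrow> (\<exists>f. loop_at Z z f \<and> A = loop_class Z z f)"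
    for A z and Z :: "'z topology"
    by (auto simp: fundamental_group_def)
  show ?thesis
  proof (rule homI)
    fix A assume "A \<in> carrier (fundamental_group X x)"
    then show "fundamental_group_map x Y \<psi> A \<in> carrier (fundamental_group Y (\<psi> x))"
      using l unfolding carr by (metis fundamental_group_map_loop_class[OF assms])
  next
    fix A B assume "A \<in> carrier (fundamental_group X x)" "B \<in> carrier (fundamental_group X x)"
    then show "fundamental_group_map x Y \<psi> (A \<otimes>\<^bsub>fundamental_group X x\<^esub> B)
        = fundamental_group_map x Y \<psi> A \<otimes>\<^bsub>fundamental_group Y (\<psi> x)\<^esub> fundamental_group_map x Y \<psi> B"
      using m unfolding carr by blast
  qed
qed


subsection \<open>CW complexes\<close>

definition unit_disc :: "nat \<Rightarrow> (nat \<Rightarrow> real) set" where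
  "unit_disc n = {x \<in> topspace (Euclidean_space n). (\<Sum>i<n. (x i)\<^sup>2) \<le> 1}"

definition open_unit_disc :: "nat \<Rightarrow> (nat \<Rightarrow> real) set" where
  "open_unit_disc n = {x \<in> topspace (Euclidean_space n). (\<Sum>i<n. (x i)\<^sup>2) < 1}"

text \<open>A CW structure in the sense of Whitehead, given by the set \<open>C\<close> of the pairs
  \<open>(n, \<phi>)\<close> of the dimension and the characteristic map of each cell. For \<open>n = 0\<close> both discs
  are the one-point set, so the boundary condition is vacuous. As \<open>X\<close> is Hausdorff, the
  compact set \<open>\<phi> ` unit_disc n\<close> is the closure of the cell \<open>\<phi> ` open_unit_disc n\<close>.\<close>

definition CW_structure :: "'a topology \<Rightarrow> (nat \<times> ((nat \<Rightarrow> real) \<Rightarrow> 'a)) set \<Rightarrow> bool" where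
  "CW_structure X C \<longleftrightarrow>
     Hausdorff_space X \<and>
     (\<forall>(n, \<phi>)\<in>C. continuous_map (subtopology (Euclidean_space n) (unit_disc n)) X \<phi> \<and>
        embedding_map (subtopology (Euclidean_space n) (open_unit_disc n)) X \<phi>) \<and>
     pairwise (\<lambda>(m, \<phi>) (n, \<theta>). disjnt (\<phi> ` open_unit_disc m) (\<theta> ` open_unit_disc n)) C \<and>
     (\<Union>(n, \<phi>)\<in>C. \<phi> ` open_unit_disc n) = topspace X \<and>
     (\<forall>(n, \<phi>)\<in>C. \<exists>D\<subseteq>C. finite D \<and> (\<forall>(m, \<theta>)\<in>D. m < n) \<and>
        \<phi> ` (unit_disc n - open_unit_disc n) \<subseteq> (\<Union>(m, \<theta>)\<in>D. \<theta> ` open_unit_disc m)) \<and>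
     (\<forall>A \<subseteq> topspace X. (\<forall>(n, \<phi>)\<in>C. closedin X (A \<inter> \<phi> ` unit_disc n)) \<longrightarrow> closedin X A)"

definition CW_complex :: "'a topology \<Rightarrow> bool" where
  "CW_complex X \<longleftrightarrow> (\<exists>C. CW_structure X C)"


subsection \<open>Integral homology equivalences\<close>

definition integral_homology_equivalence :: "'a topology \<Rightarrow> 'b topology \<Rightarrow> ('a \<Rightarrow> 'b) \<Rightarrow> bool" where
  "integral_homology_equivalence X Y \<psi> \<longleftrightarrow>
     continuous_map X Y \<psi> \<and>
     (\<forall>p. hom_induced p X {} Y {} \<psi> \<in> iso (homology_group p X) (homology_group p Y))"

end

theory Submission
  imports Defs
begin

text \<open>This is Stallings' argument with explicit cochains in place of the five-term exact sequence.
  Write \<open>G\<close>, \<open>Q\<close> for the fundamental groups, \<open>N = ker f\<close> and \<open>E = G / [N, G]\<close>, so that \<open>E \<rightarrow> Q\<close> is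
  a central extension with kernel \<open>N / [N, G]\<close>. Base paths turn a singular edge of \<open>X\<close>
  into an element of \<open>E\<close> and one of \<open>Y\<close> into an element of \<open>Q\<close>. A set-theoretic section of \<open>E \<rightarrow> Q\<close>
  gives a singular 2-cocycle \<open>c\<close> on \<open>Y\<close> with values in \<open>N / [N, G]\<close>, whose pullback to \<open>X\<close> is a
  coboundary; as \<open>H\<^sub>2 X \<rightarrow> H\<^sub>2 Y\<close> is onto, \<open>c\<close> vanishes on all 2-cycles of \<open>Y\<close>. If a loop \<open>\<gamma>\<close> in \<open>X\<close>
  becomes null-homotopic in \<open>Y\<close>, its image bounds a disc \<open>D\<close> there, and \<open>\<gamma>\<close> bounds a chain \<open>d\<close> in \<open>X\<close>
  because \<open>H\<^sub>1 X \<rightarrow> H\<^sub>1 Y\<close> is injective. Evaluating \<open>c\<close> on the cycle \<open>\<psi> d - D\<close> shows that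
  \<open>\<gamma>\<close> is trivial in \<open>E\<close>. Hence \<open>N = [N, G]\<close>.\<close>

subsection \<open>Chains and homology equivalences\<close>

text \<open>Surjectivity on homology, read on cycles. In degree 2 it replaces a cycle of the target
  by the image of a cycle of the source, up to a boundary.\<close>

lemma integral_homology_equivalence_surj:
  assumes "integral_homology_equivalence X Y \<psi>" "singular_relcycle p Y {} z"
  obtains c where "singular_relcycle p X {} c" "singular_relboundary p Y {} (chain_map p \<psi> c - z)"
proof -
  have cont: "continuous_map X Y \<psi>"
    and iso: "hom_induced (int p) X {} Y {} \<psi> \<in> iso (homology_group (int p) X) (homology_group (int p) Y)"
    using assms(1) by (auto simp: integral_homology_equivalence_def)
  have "homologous_rel_set p Y {} z \<in> carrier (homology_group (int p) Y)"
    using assms(2) by (auto simp: carrier_relative_homology_group)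
  then obtain C where "C \<in> carrier (homology_group (int p) X)"
      "hom_induced (int p) X {} Y {} \<psi> C = homologous_rel_set p Y {} z"
    using iso by (auto simp: iso_def bij_betw_def) (metis imageE)
  then obtain c where c: "singular_relcycle p X {} c"
      "hom_induced (int p) X {} Y {} \<psi> (homologous_rel_set p X {} c) = homologous_rel_set p Y {} z"
    by (auto simp: carrier_relative_homology_group)
  then have "homologous_rel p Y {} (chain_map p \<psi> c) z"
    by (simp add: hom_induced_chain_map[OF cont] homologous_rel_set_eq)
  with c show ?thesis
    using that by (simp add: homologous_rel_def)
qed

text \<open>Injectivity on homology, read on cycles. Degree 1 lets the given loop bound in the
  source; degree 0 separates path components.\<close>

lemma integral_homology_equivalence_inj:
  assumes "integral_homology_equivalence X Y \<psi>" "singular_relcycle p X {} c"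
    and "singular_relboundary p Y {} (chain_map p \<psi> c)"
  shows "singular_relboundary p X {} c"
proof -
  have cont: "continuous_map X Y \<psi>"
    and iso: "hom_induced (int p) X {} Y {} \<psi> \<in> iso (homology_group (int p) X) (homology_group (int p) Y)"
    using assms(1) by (auto simp: integral_homology_equivalence_def)
  have "homologous_rel_set p Y {} (chain_map p \<psi> c) = homologous_rel_set p Y {} (chain_map p \<psi> 0)"
    unfolding homologous_rel_set_eq using assms(3) by (simp add: homologous_rel_def)
  then have "hom_induced (int p) X {} Y {} \<psi> (homologous_rel_set p X {} c)
      = hom_induced (int p) X {} Y {} \<psi> (homologous_rel_set p X {} 0)"
    using assms(2) by (simp only: hom_induced_chain_map[OF cont] singular_relcycle_0 Pi_empty UNIV_I)
  moreover have "homologous_rel_set p X {} c \<in> carrier (homology_group (int p) X)"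
      "homologous_rel_set p X {} 0 \<in> carrier (homology_group (int p) X)"
    using assms(2) by (auto simp: carrier_relative_homology_group)
  ultimately have "homologous_rel_set p X {} c = homologous_rel_set p X {} 0"
    using iso by (auto simp: iso_def bij_betw_def dest: inj_onD)
  then show ?thesis
    unfolding homologous_rel_set_eq by (simp add: homologous_rel_def)
qed

section \<open>Homomorphisms from chain groups to abelian groups\<close>

lemma (in comm_monoid) m_interchange:
  "\<lbrakk>a \<in> carrier G; b \<in> carrier G; c \<in> carrier G; d \<in> carrier G\<rbrakk>
    \<Longrightarrow> (a \<otimes> b) \<otimes> (c \<otimes> d) = (a \<otimes> c) \<otimes> (b \<otimes> d)"
  by (simp add: m_ac)

text \<open>Universal property of free abelian groups. Generators outside \<open>S\<close> are sent
  to the unit, so that \<open>h\<close> is additive on all chains without side conditions;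
  \<open>S\<close> will be the predicate of being a singular simplex.\<close>

lemma (in comm_group) frag_hom_exists:
  assumes "\<And>\<sigma>. S \<sigma> \<Longrightarrow> f \<sigma> \<in> carrier G"
  obtains h where "\<And>c. h c \<in> carrier G" "\<And>c d. h (c + d) = h c \<otimes> h d"
    "\<And>\<sigma>. S \<sigma> \<Longrightarrow> h (frag_of \<sigma>) = f \<sigma>"
proof -
  obtain h where "h \<in> hom (free_Abelian_group UNIV) G"
      "\<And>\<sigma>. h (frag_of \<sigma>) = (if S \<sigma> then f \<sigma> else \<one>)"
    by (rule free_Abelian_group_universal[of "\<lambda>\<sigma>. if S \<sigma> then f \<sigma> else \<one>" UNIV])
       (use assms in auto)
  then show ?thesis
    using that[of h] by (auto simp: hom_def free_Abelian_group_def)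
qed

lemma (in comm_group) frag_hom_diff:
  fixes h :: "('c \<Rightarrow>\<^sub>0 int) \<Rightarrow> 'a"
  assumes "\<And>c. h c \<in> carrier G" "\<And>c d. h (c + d) = h c \<otimes> h d"
  shows "h 0 = \<one>" "h (c - d) = h c \<otimes> inv h d"
proof -
  show "h 0 = \<one>" using assms by (metis add_0 l_cancel_one')
  have "h (c - d) \<otimes> h d = h c" using assms(2)[of "c - d" d] by simp
  then show "h (c - d) = h c \<otimes> inv h d" using assms(1) inv_solve_right by metis
qed

section \<open>Faces and boundaries in low dimensions\<close>

lemma chain_boundary_1: "chain_boundary (Suc 0) (frag_of \<sigma>) =
   frag_of (singular_face (Suc 0) 0 \<sigma>) - frag_of (singular_face (Suc 0) (Suc 0) \<sigma>)"
  by (simp add: chain_boundary_of atMost_Suc)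

lemma chain_boundary_2: "chain_boundary 2 (frag_of \<tau>) =
   frag_of (singular_face 2 0 \<tau>) - frag_of (singular_face 2 1 \<tau>) + frag_of (singular_face 2 2 \<tau>)"
  by (simp add: chain_boundary_of atMost_Suc numeral_2_eq_2)

lemma chain_boundary_3: "chain_boundary 3 (frag_of \<tau>) =
   frag_of (singular_face 3 0 \<tau>) - frag_of (singular_face 3 1 \<tau>) + frag_of (singular_face 3 2 \<tau>)
     - frag_of (singular_face 3 3 \<tau>)"
  by (simp add: chain_boundary_of atMost_Suc numeral_3_eq_3 numeral_2_eq_2)

text \<open>This is the cosimplicial identity for the face inclusions. Membership in the
  intermediate simplex is checked because \<open>singular_face\<close> is restricted to it.\<close>

lemma singular_face_singular_face:
  assumes "i \<le> j" "j < p" "1 < p"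
  shows "singular_face (p - 1) i (singular_face p (Suc j) f) = singular_face (p - 1) j (singular_face p i f)"
proof
  fix t
  have "simplical_face i t \<in> standard_simplex (p - 1)" "simplical_face j t \<in> standard_simplex (p - 1)"
    if "t \<in> standard_simplex (p - 1 - 1)"
    using simplical_face_in_standard_simplex[of "p - 1" _ t] assms that by auto
  moreover have "simplical_face (Suc j) (simplical_face i t) = simplical_face i (simplical_face j t)"
    using assms(1) by (auto simp: simplical_face_def fun_eq_iff)
  ultimately show "singular_face (p - 1) i (singular_face p (Suc j) f) t
      = singular_face (p - 1) j (singular_face p i f) t"
    by (simp add: singular_face_def restrict_def)
qed

lemma singular_face_simplex_map_commute:
  assumes "1 \<le> p" "k \<le> p"
  shows "singular_face p k (simplex_map p g \<sigma>) = simplex_map (p - 1) g (singular_face p k \<sigma>)"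
  unfolding singular_face_simplex_map[OF assms]
  by (simp add: singular_face_def simplex_map_def fun_eq_iff restrict_def)

section \<open>Cochain identities with values in a group\<close>

lemma (in comm_group) frag_hom_trivial:
  fixes h :: "('c \<Rightarrow>\<^sub>0 int) \<Rightarrow> 'a"
  assumes "\<And>c. h c \<in> carrier G" "\<And>c d. h (c + d) = h c \<otimes> h d"
    and "\<And>\<sigma>. \<sigma> \<in> S \<Longrightarrow> h (frag_of \<sigma>) = \<one>" and "Poly_Mapping.keys c \<subseteq> S"
  shows "h c = \<one>"
  using assms(4)
  by (induction c rule: frag_induction) (simp_all add: assms frag_hom_diff[of h, OF assms(1,2)])

text \<open>Central factors slide out of a noncommutative coboundary: \<open>a\<close>,
  \<open>b\<close>, \<open>c\<close> are the values of a 1-cochain on the edges 01, 12, 02, and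
  \<open>x\<close>, \<open>y\<close> are central corrections on the first two. It serves to compare
  two lifts of one edge label.\<close>

lemma (in group) coboundary_identity:
  assumes e: "x \<in> carrier G" "y \<in> carrier G" "a \<in> carrier G" "b \<in> carrier G" "c \<in> carrier G"
    and x: "\<And>g. g \<in> carrier G \<Longrightarrow> x \<otimes> g = g \<otimes> x"
    and y: "\<And>g. g \<in> carrier G \<Longrightarrow> y \<otimes> g = g \<otimes> y"
  shows "(x \<otimes> a) \<otimes> (y \<otimes> b) \<otimes> inv c = (a \<otimes> b \<otimes> inv c) \<otimes> (x \<otimes> y)"
proof -
  have "(x \<otimes> a) \<otimes> (y \<otimes> b) \<otimes> inv c = x \<otimes> (a \<otimes> y) \<otimes> (b \<otimes> inv c)"
    using e by (simp add: m_assoc)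
  also have "\<dots> = x \<otimes> (y \<otimes> a) \<otimes> (b \<otimes> inv c)"
    using y[OF e(3)] by simp
  also have "\<dots> = x \<otimes> (y \<otimes> (a \<otimes> b \<otimes> inv c))"
    using e by (simp add: m_assoc)
  also have "\<dots> = x \<otimes> ((a \<otimes> b \<otimes> inv c) \<otimes> y)"
    using y[of "a \<otimes> b \<otimes> inv c"] e by simp
  also have "\<dots> = ((a \<otimes> b \<otimes> inv c) \<otimes> y) \<otimes> x"
    using x[of "(a \<otimes> b \<otimes> inv c) \<otimes> y"] e by simp
  also have "\<dots> = (a \<otimes> b \<otimes> inv c) \<otimes> (x \<otimes> y)"
    using e x[of y] by (simp add: m_assoc)
  finally show ?thesis .
qed

text \<open>For edges \<open>a = 01\<close>, \<open>b = 12\<close>, \<open>c = 23\<close>, \<open>d = 02\<close>, \<open>e = 13\<close>, \<open>f = 03\<close> of a 3-simplex.\<close>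

lemma (in group) cocycle_identity:
  assumes e: "a \<in> carrier G" "b \<in> carrier G" "c \<in> carrier G" "d \<in> carrier G" "e \<in> carrier G" "f \<in> carrier G"
    and central: "\<And>g. g \<in> carrier G \<Longrightarrow> (b \<otimes> c \<otimes> inv e) \<otimes> g = g \<otimes> (b \<otimes> c \<otimes> inv e)"
  shows "(a \<otimes> b \<otimes> inv d) \<otimes> (d \<otimes> c \<otimes> inv f) = (b \<otimes> c \<otimes> inv e) \<otimes> (a \<otimes> e \<otimes> inv f)"
proof -
  have "(b \<otimes> c \<otimes> inv e) \<otimes> (a \<otimes> e \<otimes> inv f) = (b \<otimes> c \<otimes> inv e \<otimes> a) \<otimes> (e \<otimes> inv f)"
    using e by (simp add: m_assoc)
  \<comment> \<open>The value on the face 123 passes the edge 01 by centrality; afterwards the edge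
    13 cancels and 02 can be inserted.\<close>
  also have "\<dots> = a \<otimes> b \<otimes> c \<otimes> inv e \<otimes> (e \<otimes> inv f)"
    unfolding central[OF e(1)] using e by (simp add: m_assoc)
  also have "\<dots> = (a \<otimes> b \<otimes> inv d) \<otimes> (d \<otimes> c \<otimes> inv f)"
    using e by (simp add: m_assoc inv_solve_left)
  finally show ?thesis by simp
qed

subsection \<open>Central extensions\<close>

text \<open>A conjugate of \<open>[h, k]\<close> is the commutator of the conjugates, and normality
  keeps the first of them in \<open>H\<close>. So the generating set is stable under
  conjugation.\<close>

lemma (in group) mixed_commutator_normal:
  assumes "H \<lhd> G"
  shows "mixed_commutator G H (carrier G) \<lhd> G"
  unfolding mixed_commutator_def
proof (rule normal_generateI)
  interpret H: normal H G by fact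
  show "(\<Union>h\<in>H. \<Union>k\<in>carrier G. {h \<otimes> k \<otimes> inv h \<otimes> inv k}) \<subseteq> carrier G"
    by auto
  fix c g assume "c \<in> (\<Union>h\<in>H. \<Union>k\<in>carrier G. {h \<otimes> k \<otimes> inv h \<otimes> inv k})" and g: "g \<in> carrier G"
  then obtain h k where hk: "h \<in> H" "k \<in> carrier G" "c = h \<otimes> k \<otimes> inv h \<otimes> inv k"
    by auto
  have h: "h \<in> carrier G" using hk(1) by simp
  let ?h = "g \<otimes> h \<otimes> inv g" and ?k = "g \<otimes> k \<otimes> inv g"
  have "inv g \<otimes> (g \<otimes> z) = z" if "z \<in> carrier G" for z
    using g that by (simp flip: m_assoc)
  then have "g \<otimes> c \<otimes> inv g = ?h \<otimes> ?k \<otimes> inv ?h \<otimes> inv ?k"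
    using h hk(2) g by (simp add: hk(3) m_assoc inv_mult_group)
  moreover have "?h \<in> H" "?k \<in> carrier G"
    using hk g by (simp_all add: H.inv_op_closed2)
  ultimately show "g \<otimes> c \<otimes> inv g \<in> (\<Union>h\<in>H. \<Union>k\<in>carrier G. {h \<otimes> k \<otimes> inv h \<otimes> inv k})"
    by blast
qed

text \<open>The products in the two orders differ by \<open>[h, g]\<close>, which lies in
  \<open>K\<close>. With \<open>H\<close> the kernel of an epimorphism, the quotient by
  \<open>K\<close> thus becomes a central extension of the image.\<close>

lemma (in group) FactGroup_mixed_commutator_central:
  assumes "H \<lhd> G" "h \<in> H" "g \<in> carrier G"
  defines "K \<equiv> mixed_commutator G H (carrier G)"
  shows "(K #> h) \<otimes>\<^bsub>G Mod K\<^esub> (K #> g) = (K #> g) \<otimes>\<^bsub>G Mod K\<^esub> (K #> h)"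
proof -
  interpret H: normal H G by fact
  interpret K: normal K G
    unfolding K_def using assms(1) by (rule mixed_commutator_normal)
  have h: "h \<in> carrier G" using assms(2) by simp
  have K: "h \<otimes> g \<otimes> inv h \<otimes> inv g \<in> K"
    using assms(2,3) unfolding K_def mixed_commutator_def by (intro generate.incl) blast
  have eq: "h \<otimes> g = (h \<otimes> g \<otimes> inv h \<otimes> inv g) \<otimes> (g \<otimes> h)"
  proof -
    have "(h \<otimes> g \<otimes> inv h \<otimes> inv g) \<otimes> (g \<otimes> h) = (h \<otimes> g) \<otimes> (inv h \<otimes> ((inv g \<otimes> g) \<otimes> h))"
      using h assms(3) by (simp only: m_assoc m_closed inv_closed)
    then show ?thesis using h assms(3) by simp
  qed
  have "K #> (h \<otimes> g) = (K #> (h \<otimes> g \<otimes> inv h \<otimes> inv g)) #> (g \<otimes> h)"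
    using h assms(3) by (subst eq, subst coset_mult_assoc[OF K.subset]) simp_all
  also have "K #> (h \<otimes> g \<otimes> inv h \<otimes> inv g) = K"
    using K by (rule K.rcos_const[OF is_group])
  finally have "K #> (h \<otimes> g) = K #> (g \<otimes> h)" .
  then show ?thesis
    using h assms(3) by (simp add: K.rcos_sum FactGroup_def)
qed

text \<open>Stallings' argument, with the topology reduced to labels on edges. \<open>k\<close> and
  \<open>m\<close> are multiplicative labellings, \<open>\<gamma>\<close> is a loop, and
  \<open>D\<close> is a disc in \<open>Y\<close> bounded by its image. Lifting \<open>m\<close> to
  \<open>E\<close> costs a 2-cocycle in the central kernel; it vanishes on the cycle formed from
  \<open>D\<close> and a chain in \<open>X\<close> with boundary \<open>\<gamma>\<close>, and this
  forces the label of \<open>\<gamma>\<close> to be trivial.\<close>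

lemma central_extension_boundary_trivial:
  fixes E :: "('e, 'm) monoid_scheme" and Q :: "('q, 'n) monoid_scheme"
    and \<psi> :: "'a \<Rightarrow> 'b"
  assumes "group E" "group Q" "p \<in> epi E Q"
    and central: "\<And>a e. a \<in> kernel E Q p \<Longrightarrow> e \<in> carrier E \<Longrightarrow> a \<otimes>\<^bsub>E\<^esub> e = e \<otimes>\<^bsub>E\<^esub> a"
    and \<psi>: "integral_homology_equivalence X Y \<psi>"
    and k: "\<And>\<sigma>. singular_simplex 1 X \<sigma> \<Longrightarrow> k \<sigma> \<in> carrier E"
    and k_mult: "\<And>\<tau>. singular_simplex 2 X \<tau> \<Longrightarrow>
      k (singular_face 2 2 \<tau>) \<otimes>\<^bsub>E\<^esub> k (singular_face 2 0 \<tau>) = k (singular_face 2 1 \<tau>)"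
    and m: "\<And>\<sigma>. singular_simplex 1 Y \<sigma> \<Longrightarrow> m \<sigma> \<in> carrier Q"
    and m_mult: "\<And>\<tau>. singular_simplex 2 Y \<tau> \<Longrightarrow>
      m (singular_face 2 2 \<tau>) \<otimes>\<^bsub>Q\<^esub> m (singular_face 2 0 \<tau>) = m (singular_face 2 1 \<tau>)"
    and compat: "\<And>\<sigma>. singular_simplex 1 X \<sigma> \<Longrightarrow> p (k \<sigma>) = m (simplex_map 1 \<psi> \<sigma>)"
    and \<gamma>: "singular_simplex 1 X \<gamma>" "singular_face 1 0 \<gamma> = singular_face 1 1 \<gamma>"
    and D: "singular_simplex 2 Y D" "singular_face 2 2 D = simplex_map 1 \<psi> \<gamma>"
      "singular_face 2 0 D = singular_face 2 1 D"
  shows "k \<gamma> = \<one>\<^bsub>E\<^esub>"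
proof -
  interpret E: group E by fact
  interpret Q: group Q by fact
  interpret p: group_hom E Q p
    using assms(3) by unfold_locales (auto simp: epi_def)
  have cont: "continuous_map X Y \<psi>"
    using \<psi> by (auto simp: integral_homology_equivalence_def)

  \<comment> \<open>The extension cocycle and the associated cochains\<close>
  define A where "A = E\<lparr>carrier := kernel E Q p\<rparr>"
  have A[simp]: "carrier A = kernel E Q p" "x \<otimes>\<^bsub>A\<^esub> y = x \<otimes>\<^bsub>E\<^esub> y" "\<one>\<^bsub>A\<^esub> = \<one>\<^bsub>E\<^esub>" for x y
    by (auto simp: A_def)
  have "group A"
    unfolding A_def by (rule subgroup.subgroup_is_group[OF p.subgroup_kernel \<open>group E\<close>])
  then interpret A: comm_group A
    by (rule group.group_comm_groupI) (auto intro: central simp: kernel_def)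
  have AE: "x \<in> kernel E Q p \<Longrightarrow> x \<in> carrier E" for x
    by (simp add: kernel_def)
  have "\<forall>q\<in>carrier Q. \<exists>e. e \<in> carrier E \<and> p e = q"
    using assms(3) by (auto simp: epi_def image_iff) (metis imageE)
  then obtain s where s: "\<And>q. q \<in> carrier Q \<Longrightarrow> s q \<in> carrier E" "\<And>q. q \<in> carrier Q \<Longrightarrow> p (s q) = q"
    by metis
  \<comment> \<open>\<open>s\<close> is merely a set-theoretic section, so the lifted label
    \<open>e\<close> need not be multiplicative on triangles.\<close>
  define e where "e \<sigma> = s (m \<sigma>)" for \<sigma>
  have e: "e \<sigma> \<in> carrier E" "p (e \<sigma>) = m \<sigma>" if "singular_simplex 1 Y \<sigma>" for \<sigma>
    using that m s by (auto simp: e_def)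
  have face2: "singular_simplex 1 Z (singular_face 2 i \<tau>)" if "singular_simplex 2 Z \<tau>" "i \<le> 2"
    for Z :: "'z topology" and \<tau> i
    using singular_simplex_singular_face[of 2 Z \<tau> i] that by simp
  have face3: "singular_simplex 2 Z (singular_face 3 i \<tau>)" if "singular_simplex 3 Z \<tau>" "i \<le> 3"
    for Z :: "'z topology" and \<tau> i
    using singular_simplex_singular_face[of 3 Z \<tau> i] that by simp
  \<comment> \<open>Faces 2, 0, 1 of a triangle are its edges 01, 12, 02, so \<open>c\<close> is the
    multiplicative defect of \<open>e\<close>. Since \<open>m\<close> has no defect,
    \<open>c\<close> takes values in the kernel.\<close>
  define c where
    "c \<tau> = e (singular_face 2 2 \<tau>) \<otimes>\<^bsub>E\<^esub> e (singular_face 2 0 \<tau>) \<otimes>\<^bsub>E\<^esub> inv\<^bsub>E\<^esub> e (singular_face 2 1 \<tau>)" for \<tau>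
  \<comment> \<open>The difference of two lifts, \<open>k\<close> and \<open>e\<close>, of the label
    of the image edge. Both lie over the same element of \<open>Q\<close>, so \<open>b\<close> takes
    values in the kernel as well.\<close>
  define b where "b \<sigma> = k \<sigma> \<otimes>\<^bsub>E\<^esub> inv\<^bsub>E\<^esub> e (simplex_map 1 \<psi> \<sigma>)" for \<sigma>
  have cA: "c \<tau> \<in> kernel E Q p" if "singular_simplex 2 Y \<tau>" for \<tau>
    using face2[OF that, of 0] face2[OF that, of 1] face2[OF that, of 2] m_mult[OF that] m
    by (simp add: c_def kernel_def e)
  have smap: "singular_simplex n Y (simplex_map n \<psi> \<sigma>)" if "singular_simplex n X \<sigma>" for n \<sigma>
    using that cont by (rule singular_simplex_simplex_map)
  have bA: "b \<sigma> \<in> kernel E Q p" if "singular_simplex 1 X \<sigma>" for \<sigma>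
    using smap[OF that] k[OF that] compat[OF that] m by (simp add: b_def kernel_def e)
  obtain hc where hc: "\<And>z. hc z \<in> kernel E Q p" "\<And>z w. hc (z + w) = hc z \<otimes>\<^bsub>A\<^esub> hc w"
      "\<And>\<tau>. singular_simplex 2 Y \<tau> \<Longrightarrow> hc (frag_of \<tau>) = c \<tau>"
    using A.frag_hom_exists[of "singular_simplex 2 Y" c] cA unfolding A by blast
  obtain hb where hb: "\<And>z. hb z \<in> kernel E Q p" "\<And>z w. hb (z + w) = hb z \<otimes>\<^bsub>A\<^esub> hb w"
      "\<And>\<sigma>. singular_simplex 1 X \<sigma> \<Longrightarrow> hb (frag_of \<sigma>) = b \<sigma>"
    using A.frag_hom_exists[of "singular_simplex 1 X" b] bA unfolding A by blast
  note hc_diff = A.frag_hom_diff[of hc, unfolded A(1), OF hc(1,2)]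
  note hb_diff = A.frag_hom_diff[of hb, unfolded A(1), OF hb(1,2)]

  \<comment> \<open>The cocycle condition\<close>
  have cocycle: "hc (chain_boundary 3 z) = \<one>\<^bsub>A\<^esub>" if "singular_chain 3 Y z" for z
  proof (rule A.frag_hom_trivial[where h = "\<lambda>z. hc (chain_boundary 3 z)" and S = "singular_simplex_set 3 Y"])
    show "Poly_Mapping.keys z \<subseteq> singular_simplex_set 3 Y"
      using that by (simp add: singular_chain_def)
    fix \<tau> assume "\<tau> \<in> singular_simplex_set 3 Y"
    then have \<tau>: "singular_simplex 3 Y \<tau>" by simp
    let ?F = "\<lambda>i. singular_face 3 i \<tau>"
    have F: "singular_simplex 2 Y (?F i)" if "i \<le> 3" for i using face3[OF \<tau>] that by simp
    have F': "singular_simplex 1 Y (singular_face 2 j (?F i))" if "i \<le> 3" "j \<le> 2" for i j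
      using face2[OF F] that by simp
    \<comment> \<open>Each of the six edges of the tetrahedron is shared by two of its faces;
      rewriting with these identities gives the shape of \<open>E.cocycle_identity\<close>.\<close>
    have ids: "singular_face 2 0 (?F 1) = singular_face 2 0 (?F 0)"
      "singular_face 2 0 (?F 2) = singular_face 2 1 (?F 0)"
      "singular_face 2 0 (?F 3) = singular_face 2 2 (?F 0)"
      "singular_face 2 1 (?F 2) = singular_face 2 1 (?F 1)"
      "singular_face 2 1 (?F 3) = singular_face 2 2 (?F 1)"
      "singular_face 2 2 (?F 3) = singular_face 2 2 (?F 2)"
      using singular_face_singular_face[of 0 0 3 \<tau>] singular_face_singular_face[of 0 1 3 \<tau>]
        singular_face_singular_face[of 0 2 3 \<tau>] singular_face_singular_face[of 1 1 3 \<tau>]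
        singular_face_singular_face[of 1 2 3 \<tau>] singular_face_singular_face[of 2 2 3 \<tau>]
      by (simp_all add: eval_nat_numeral)
    have cen: "c (?F 0) \<otimes>\<^bsub>E\<^esub> g = g \<otimes>\<^bsub>E\<^esub> c (?F 0)" if "g \<in> carrier E" for g
      using central[OF cA[OF F] that] by simp
    have eq: "c (?F 3) \<otimes>\<^bsub>E\<^esub> c (?F 1) = c (?F 0) \<otimes>\<^bsub>E\<^esub> c (?F 2)"
      unfolding c_def ids
      by (rule E.cocycle_identity)
         (use e F' cen in \<open>auto simp: c_def\<close>)
    \<comment> \<open>Adding the two faces of negative sign turns the boundary into a sum, so that
      additivity of \<open>hc\<close> suffices and inverses do not enter.\<close>
    have "hc (chain_boundary 3 (frag_of \<tau>)) \<otimes>\<^bsub>A\<^esub> (c (?F 3) \<otimes>\<^bsub>A\<^esub> c (?F 1))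
        = hc (chain_boundary 3 (frag_of \<tau>) + (frag_of (?F 3) + frag_of (?F 1)))"
      using F by (simp add: hc(2,3))
    also have "chain_boundary 3 (frag_of \<tau>) + (frag_of (?F 3) + frag_of (?F 1)) = frag_of (?F 0) + frag_of (?F 2)"
      by (simp add: chain_boundary_3)
    also have "hc \<dots> = c (?F 3) \<otimes>\<^bsub>A\<^esub> c (?F 1)"
      using F eq by (simp add: hc(2,3))
    finally show "hc (chain_boundary 3 (frag_of \<tau>)) = \<one>\<^bsub>A\<^esub>"
      using AE[OF hc(1)] AE[OF cA[OF F]] by simp
  qed (use hc in \<open>auto simp: chain_boundary_add\<close>)

  \<comment> \<open>The pullback of the cocycle is a coboundary\<close>
  have pullback: "hc (chain_map 2 \<psi> z) \<otimes>\<^bsub>A\<^esub> hb (chain_boundary 2 z) = \<one>\<^bsub>A\<^esub>" if "singular_chain 2 X z" for z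
  proof (rule A.frag_hom_trivial[where h = "\<lambda>z. hc (chain_map 2 \<psi> z) \<otimes>\<^bsub>A\<^esub> hb (chain_boundary 2 z)"
        and S = "singular_simplex_set 2 X"])
    show "Poly_Mapping.keys z \<subseteq> singular_simplex_set 2 X"
      using that by (simp add: singular_chain_def)
    show "hc (chain_map 2 \<psi> z) \<otimes>\<^bsub>A\<^esub> hb (chain_boundary 2 z) \<in> carrier A" for z
      using A.m_closed hc(1) hb(1) unfolding A(1) by blast
    show "hc (chain_map 2 \<psi> (z + w)) \<otimes>\<^bsub>A\<^esub> hb (chain_boundary 2 (z + w))
      = hc (chain_map 2 \<psi> z) \<otimes>\<^bsub>A\<^esub> hb (chain_boundary 2 z) \<otimes>\<^bsub>A\<^esub> (hc (chain_map 2 \<psi> w) \<otimes>\<^bsub>A\<^esub> hb (chain_boundary 2 w))"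
      for z w
      unfolding chain_map_add chain_boundary_add hc(2) hb(2)
      by (rule A.m_interchange) (use hc hb in auto)
    fix \<tau> assume "\<tau> \<in> singular_simplex_set 2 X"
    then have \<tau>: "singular_simplex 2 X \<tau>" by simp
    define \<tau>' where "\<tau>' = simplex_map 2 \<psi> \<tau>"
    have \<tau>': "singular_simplex 2 Y \<tau>'" using smap[OF \<tau>] by (simp add: \<tau>'_def)
    let ?F = "\<lambda>i. singular_face 2 i \<tau>"
    have F: "singular_simplex 1 X (?F i)" if "i \<le> 2" for i using face2[OF \<tau>] that by simp
    have F': "singular_face 2 i \<tau>' = simplex_map 1 \<psi> (?F i)" if "i \<le> 2" for i
      using that by (simp add: \<tau>'_def singular_face_simplex_map_commute)
    have kb: "k (?F i) = b (?F i) \<otimes>\<^bsub>E\<^esub> e (singular_face 2 i \<tau>')" if "i \<le> 2" for i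
      using k[OF F[OF that]] e(1)[OF smap[OF F[OF that]]] by (simp add: b_def F' that E.m_assoc)
    have eF: "e (singular_face 2 i \<tau>') \<in> carrier E" if "i \<le> 2" for i
      using e(1)[OF face2[OF \<tau>' that]] .
    \<comment> \<open>As \<open>k\<close> is multiplicative on \<open>\<tau>\<close>, the label
      \<open>k (?F 1)\<close> expands over the other two edges; each of their labels is then written
      as \<open>b\<close> times \<open>e\<close>.\<close>
    have "b (?F 1) = k (?F 2) \<otimes>\<^bsub>E\<^esub> k (?F 0) \<otimes>\<^bsub>E\<^esub> inv\<^bsub>E\<^esub> e (singular_face 2 1 \<tau>')"
      by (simp add: b_def F' k_mult[OF \<tau>])
    also have "\<dots> = c \<tau>' \<otimes>\<^bsub>E\<^esub> (b (?F 2) \<otimes>\<^bsub>E\<^esub> b (?F 0))"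
      unfolding c_def kb[OF order_refl] kb[OF zero_le]
      by (rule E.coboundary_identity) (use eF AE central bA F in auto)
    finally have b1: "b (?F 1) = c \<tau>' \<otimes>\<^bsub>E\<^esub> (b (?F 2) \<otimes>\<^bsub>E\<^esub> b (?F 0))" .
    let ?h = "hb (chain_boundary 2 (frag_of \<tau>))"
    have "chain_boundary 2 (frag_of \<tau>) + frag_of (?F 1) = frag_of (?F 2) + frag_of (?F 0)"
      by (simp add: chain_boundary_2)
    from arg_cong[OF this, of hb] have "?h \<otimes>\<^bsub>E\<^esub> b (?F 1) = b (?F 2) \<otimes>\<^bsub>E\<^esub> b (?F 0)"
      using F by (simp add: hb(2,3))
    then have "(c \<tau>' \<otimes>\<^bsub>E\<^esub> ?h) \<otimes>\<^bsub>E\<^esub> b (?F 1) = b (?F 1)"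
      using AE[OF hb(1)] AE[OF bA[OF F]] AE[OF cA[OF \<tau>']] b1 by (simp add: E.m_assoc)
    then have "c \<tau>' \<otimes>\<^bsub>E\<^esub> ?h = \<one>\<^bsub>E\<^esub>"
      using AE[OF hb(1)] AE[OF bA[OF F]] AE[OF cA[OF \<tau>']] by simp
    then show "hc (chain_map 2 \<psi> (frag_of \<tau>)) \<otimes>\<^bsub>A\<^esub> ?h = \<one>\<^bsub>A\<^esub>"
      using hc(3)[OF \<tau>'] by (simp add: \<tau>'_def)
  qed

  \<comment> \<open>Evaluation on a 2-cycle of the target\<close>
  have D_bd: "chain_boundary 2 (frag_of D) = frag_of (simplex_map 1 \<psi> \<gamma>)"
    by (simp add: chain_boundary_2 D)
  \<comment> \<open>The two equal faces of \<open>D\<close> cancel, so the image of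
    \<open>\<gamma>\<close> is a boundary in \<open>Y\<close>; injectivity on H_1 brings this back
    to \<open>X\<close>.\<close>
  have "singular_relboundary 1 X {} (frag_of \<gamma>)"
  proof (rule integral_homology_equivalence_inj[OF \<psi>])
    show "singular_relcycle 1 X {} (frag_of \<gamma>)"
      using \<gamma> by (simp add: singular_cycle singular_chain_of chain_boundary_1)
    show "singular_relboundary 1 Y {} (chain_map 1 \<psi> (frag_of \<gamma>))"
      unfolding singular_boundary using D_bd D(1)
      by (intro exI[of _ "frag_of D"]) (simp add: singular_chain_of numeral_2_eq_2)
  qed
  then obtain d where d: "singular_chain 2 X d" "chain_boundary 2 d = frag_of \<gamma>"
    unfolding singular_boundary by (auto simp: numeral_2_eq_2)
  \<comment> \<open>Both chains have the image of \<open>\<gamma>\<close> as their boundary.\<close>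
  have "singular_relcycle 2 Y {} (chain_map 2 \<psi> d - frag_of D)"
    using d D(1) singular_chain_chain_map[OF d(1) cont] chain_boundary_chain_map[OF d(1), of \<psi>]
    by (simp add: singular_cycle singular_chain_diff singular_chain_of chain_boundary_diff D_bd)
  then obtain z where z: "singular_relcycle 2 X {} z"
      "singular_relboundary 2 Y {} (chain_map 2 \<psi> z - (chain_map 2 \<psi> d - frag_of D))"
    using integral_homology_equivalence_surj[OF \<psi>] by blast
  then obtain w where w: "singular_chain 3 Y w"
      "chain_boundary 3 w = chain_map 2 \<psi> z - (chain_map 2 \<psi> d - frag_of D)"
    unfolding singular_boundary by (auto simp: numeral_3_eq_3 numeral_2_eq_2)
  \<comment> \<open>\<open>z\<close> is a cycle, so the factor coming from \<open>hb\<close> is its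
    value at 0.\<close>
  have hcz: "hc (chain_map 2 \<psi> z) = \<one>\<^bsub>A\<^esub>"
    using pullback[of z] z(1) hb_diff(1) hc(1) AE by (auto simp: singular_cycle)
  have "chain_map 2 \<psi> d + chain_boundary 3 w = chain_map 2 \<psi> z + frag_of D"
    by (simp add: w(2))
  from arg_cong[OF this, of hc] have "hc (chain_map 2 \<psi> d) = c D"
    using hcz cocycle[OF w(1)] AE[OF hc(1)] AE[OF cA[OF D(1)]] by (simp add: hc(2) hc(3)[OF D(1)])
  \<comment> \<open>The equal faces 0 and 1 cancel in the definition of \<open>c\<close>, leaving
    the lift of the third edge.\<close>
  also have "c D = e (simplex_map 1 \<psi> \<gamma>)"
    using e(1)[OF face2[OF D(1)]] by (simp add: c_def D(3) E.m_assoc) (simp add: D(2))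
  finally have "e (simplex_map 1 \<psi> \<gamma>) \<otimes>\<^bsub>E\<^esub> b \<gamma> = \<one>\<^bsub>E\<^esub>"
    using pullback[OF d(1)] by (simp add: d(2) hb(3)[OF \<gamma>(1)])
  \<comment> \<open>\<open>b \<gamma>\<close> is \<open>k \<gamma>\<close> times the inverse of the
    same lift, so the relation says that a conjugate of \<open>k \<gamma>\<close> is
    trivial.\<close>
  then have "e (simplex_map 1 \<psi> \<gamma>) \<otimes>\<^bsub>E\<^esub> k \<gamma> = e (simplex_map 1 \<psi> \<gamma>)"
    using e(1)[OF smap[OF \<gamma>(1)]] k[OF \<gamma>(1)]
    by (simp add: b_def E.inv_solve_right' flip: E.m_assoc)
  then show ?thesis
    using e(1)[OF smap[OF \<gamma>(1)]] k[OF \<gamma>(1)] by simp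
qed

subsection \<open>The fundamental groupoid\<close>

text \<open>The fixed endpoints are read off the first path; \<open>path_homotopic_imp_ends\<close>
  recovers the symmetry. Different endpoints are allowed because singular edges have arbitrary
  ends.\<close>

definition path_homotopic :: "'a topology \<Rightarrow> (real \<Rightarrow> 'a) \<Rightarrow> (real \<Rightarrow> 'a) \<Rightarrow> bool" where
  "path_homotopic X f = homotopic_with (\<lambda>r. r 0 = f 0 \<and> r 1 = f 1) (top_of_set {0..1::real}) X f"

definition path_class :: "'a topology \<Rightarrow> (real \<Rightarrow> 'a) \<Rightarrow> (real \<Rightarrow> 'a) set" where
  "path_class X f = {g. path_homotopic X f g}"

definition path_between :: "'a topology \<Rightarrow> 'a \<Rightarrow> 'a \<Rightarrow> (real \<Rightarrow> 'a) \<Rightarrow> bool" where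
  "path_between X p q f \<longleftrightarrow> pathin X f \<and> f 0 = p \<and> f 1 = q"

definition path_classes :: "'a topology \<Rightarrow> 'a \<Rightarrow> 'a \<Rightarrow> (real \<Rightarrow> 'a) set set" where
  "path_classes X p q = path_class X ` Collect (path_between X p q)"

definition path_mult :: "'a topology \<Rightarrow> (real \<Rightarrow> 'a) set \<Rightarrow> (real \<Rightarrow> 'a) set \<Rightarrow> (real \<Rightarrow> 'a) set" where
  "path_mult X A B = (\<Union>f\<in>A. \<Union>g\<in>B. path_class X (concat_loops f g))"

definition path_map :: "'b topology \<Rightarrow> ('a \<Rightarrow> 'b) \<Rightarrow> (real \<Rightarrow> 'a) set \<Rightarrow> (real \<Rightarrow> 'b) set" where
  "path_map Y \<psi> A = (\<Union>f\<in>A. path_class Y (\<psi> \<circ> f))"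

text \<open>The endpoint condition depends on values in the unit interval alone, so a homotopy has
  to match \<open>f\<close> and \<open>g\<close> there and nowhere else.\<close>

lemma path_homotopic_iff:
  "path_homotopic X f g \<longleftrightarrow>
     (\<exists>h. continuous_map (prod_topology (top_of_set {0..1::real}) (top_of_set {0..1::real})) X h \<and>
        (\<forall>t\<in>{0..1}. h (0, t) = f t) \<and> (\<forall>t\<in>{0..1}. h (1, t) = g t) \<and>
        (\<forall>s\<in>{0..1}. h (s, 0) = f 0 \<and> h (s, 1) = f 1))"
  unfolding path_homotopic_def by (subst homotopic_with) auto

lemma path_homotopic_imp_ends:
  assumes "path_homotopic X f g"
  shows "g 0 = f 0" "g 1 = f 1"
  using homotopic_with_imp_property[OF assms[unfolded path_homotopic_def]] by auto

lemma path_homotopic_refl: "path_homotopic X f f \<longleftrightarrow> pathin X f"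
  by (auto simp: path_homotopic_def pathin_def homotopic_with_refl)

lemma path_homotopic_sym:
  assumes "path_homotopic X f g"
  shows "path_homotopic X g f"
  unfolding path_homotopic_def
  using homotopic_with_symD[OF assms[unfolded path_homotopic_def]] path_homotopic_imp_ends[OF assms] by auto

lemma path_homotopic_trans:
  assumes "path_homotopic X f g" "path_homotopic X g h"
  shows "path_homotopic X f h"
proof -
  have "homotopic_with (\<lambda>r. r 0 = f 0 \<and> r 1 = f 1) (top_of_set {0..1}) X g h"
    using assms(2) path_homotopic_imp_ends[OF assms(1)] by (simp add: path_homotopic_def)
  then show ?thesis
    using assms(1) unfolding path_homotopic_def by (rule homotopic_with_trans[rotated])
qed

lemma path_class_eq: "path_homotopic X f g \<Longrightarrow> path_class X f = path_class X g"
  unfolding path_class_def by (blast intro: path_homotopic_sym path_homotopic_trans)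

lemma path_class_eqD: "path_class X f = path_class X g \<Longrightarrow> pathin X f \<Longrightarrow> path_homotopic X f g"
  using path_homotopic_refl[of X f] by (auto simp: path_class_def intro: path_homotopic_sym)

lemma path_class_self: "pathin X f \<Longrightarrow> f \<in> path_class X f"
  by (simp add: path_class_def path_homotopic_refl)

text \<open>The homotopies run side by side in the path parameter; both are stationary at the common
  endpoint, so they agree on the seam at 1/2.\<close>

lemma path_homotopic_concat:
  assumes "path_homotopic X f f'" "path_homotopic X g g'" "f 1 = g 0"
  shows "path_homotopic X (concat_loops f g) (concat_loops f' g')"
proof -
  let ?I = "top_of_set {0..1::real}"
  let ?II = "prod_topology ?I ?I"
  obtain h where h: "continuous_map ?II X h" "\<forall>t\<in>{0..1}. h (0, t) = f t" "\<forall>t\<in>{0..1}. h (1, t) = f' t"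
      "\<forall>s\<in>{0..1}. h (s, 0) = f 0 \<and> h (s, 1) = f 1"
    using assms(1) unfolding path_homotopic_iff by blast
  obtain k where k: "continuous_map ?II X k" "\<forall>t\<in>{0..1}. k (0, t) = g t" "\<forall>t\<in>{0..1}. k (1, t) = g' t"
      "\<forall>s\<in>{0..1}. k (s, 0) = g 0 \<and> k (s, 1) = g 1"
    using assms(2) unfolding path_homotopic_iff by blast
  define H where "H = (\<lambda>p::real\<times>real. if snd p \<le> 1/2 then h (fst p, 2 * snd p) else k (fst p, 2 * snd p - 1))"
  have top: "?II = top_of_set ({0..1} \<times> {0..1})" by (simp add: subtopology_Times)
  have "continuous_map ?II X H"
    unfolding H_def
  proof (rule continuous_map_cases_le)
    show "continuous_map ?II euclideanreal snd"
      by (simp add: top continuous_on_snd)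
    show "continuous_map ?II euclideanreal (\<lambda>p. 1/2)" by simp
    have "continuous_map (subtopology ?II {p \<in> topspace ?II. snd p \<le> 1/2}) ?II (\<lambda>p. (fst p, 2 * snd p))"
      unfolding top subtopology_subtopology
      by (auto intro!: continuous_intros simp: continuous_map_in_subtopology)
    from continuous_map_compose[OF this h(1)]
    show "continuous_map (subtopology ?II {p \<in> topspace ?II. snd p \<le> 1/2}) X (\<lambda>p. h (fst p, 2 * snd p))"
      by (simp add: o_def)
    have "continuous_map (subtopology ?II {p \<in> topspace ?II. 1/2 \<le> snd p}) ?II (\<lambda>p. (fst p, 2 * snd p - 1))"
      unfolding top subtopology_subtopology
      by (auto intro!: continuous_intros simp: continuous_map_in_subtopology)
    from continuous_map_compose[OF this k(1)]
    show "continuous_map (subtopology ?II {p \<in> topspace ?II. 1/2 \<le> snd p}) X (\<lambda>p. k (fst p, 2 * snd p - 1))"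
      by (simp add: o_def)
  next
    fix p assume "p \<in> topspace ?II" and p: "snd p = 1/2"
    then have "fst p \<in> {0..1}" by auto
    then show "h (fst p, 2 * snd p) = k (fst p, 2 * snd p - 1)" using h(4) k(4) assms(3) by (simp add: p)
  qed
  then show ?thesis
    unfolding path_homotopic_iff
    by (intro exI[of _ H]) (use h k in \<open>auto simp: H_def concat_loops_def\<close>)
qed

lemma pathin_concat: "pathin X f \<Longrightarrow> pathin X g \<Longrightarrow> f 1 = g 0 \<Longrightarrow> pathin X (concat_loops f g)"
  using path_homotopic_concat[of X f f g g] by (simp add: path_homotopic_refl)

text \<open>Straight-line homotopy in \<open>S\<close>, followed by \<open>F\<close>. With the unit
  interval as \<open>S\<close> it gives invariance under reparametrisation, with a triangle the
  relation among the edges of a 2-simplex.\<close>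

lemma path_homotopic_convex:
  fixes S :: "'n::real_normed_vector set"
  assumes S: "convex S" and F: "continuous_map (top_of_set S) X F"
    and \<alpha>: "continuous_on {0..1} \<alpha>" "\<And>t::real. t \<in> {0..1} \<Longrightarrow> \<alpha> t \<in> S"
    and \<beta>: "continuous_on {0..1} \<beta>" "\<And>t::real. t \<in> {0..1} \<Longrightarrow> \<beta> t \<in> S"
    and ends: "\<alpha> 0 = \<beta> 0" "\<alpha> 1 = \<beta> 1"
    and f: "\<And>t. t \<in> {0..1} \<Longrightarrow> f t = F (\<alpha> t)" and g: "\<And>t. t \<in> {0..1} \<Longrightarrow> g t = F (\<beta> t)"
  shows "path_homotopic X f g"
proof -
  let ?I = "top_of_set {0..1::real}"
  let ?II = "prod_topology ?I ?I"
  define r where "r = (\<lambda>(s::real, t). (1 - s) *\<^sub>R \<alpha> t + s *\<^sub>R \<beta> t)"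
  have rS: "r (s, t) \<in> S" if "s \<in> {0..1}" "t \<in> {0..1}" for s t
    using convexD_alt[OF S \<alpha>(2)[OF that(2)] \<beta>(2)[OF that(2)], of s] that(1) by (auto simp: r_def)
  have "continuous_on ({0..1} \<times> {0..1}) (\<lambda>p. \<alpha> (snd p))" "continuous_on ({0..1} \<times> {0..1}) (\<lambda>p. \<beta> (snd p))"
    by (auto intro!: continuous_on_compose2[OF \<alpha>(1)] continuous_on_compose2[OF \<beta>(1)] continuous_intros)
  then have "continuous_on ({0..1} \<times> {0..1}) r"
    unfolding r_def case_prod_beta by (intro continuous_intros)
  then have "continuous_map ?II (top_of_set S) r"
    using rS by (auto simp: subtopology_Times[symmetric] continuous_map_in_subtopology)
  from continuous_map_compose[OF this F]
  have "continuous_map ?II X (F \<circ> r)" .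
  then show ?thesis
    unfolding path_homotopic_iff
    by (intro exI[of _ "F \<circ> r"]) (use ends f g in \<open>auto simp: r_def simp flip: scaleR_add_left\<close>)
qed

lemma path_homotopic_reparam:
  assumes "pathin X f"
    and "continuous_on {0..1} \<alpha>" "\<And>t. t \<in> {0..1} \<Longrightarrow> \<alpha> t \<in> {0..1::real}"
    and "continuous_on {0..1} \<beta>" "\<And>t. t \<in> {0..1} \<Longrightarrow> \<beta> t \<in> {0..1::real}"
    and "\<alpha> 0 = \<beta> 0" "\<alpha> 1 = \<beta> 1"
    and "\<And>t. t \<in> {0..1} \<Longrightarrow> p t = f (\<alpha> t)" and "\<And>t. t \<in> {0..1} \<Longrightarrow> q t = f (\<beta> t)"
  shows "path_homotopic X p q"
  by (rule path_homotopic_convex[of "{0..1}" X f \<alpha> \<beta>]) (use assms in \<open>auto simp: pathin_def\<close>)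

section \<open>Groupoid laws for path classes\<close>

lemma path_mult_class:
  assumes "path_between X p q f" "path_between X q r g"
  shows "path_mult X (path_class X f) (path_class X g) = path_class X (concat_loops f g)"
proof -
  have "path_class X (concat_loops f' g') = path_class X (concat_loops f g)"
    if "f' \<in> path_class X f" "g' \<in> path_class X g" for f' g'
    using that assms path_homotopic_concat[of X f f' g g'] path_class_eq
    by (fastforce simp: path_class_def path_between_def)
  moreover have "f \<in> path_class X f" "g \<in> path_class X g"
    using assms by (auto simp: path_class_self path_between_def)
  ultimately show ?thesis
    unfolding path_mult_def by blast
qed

lemma path_between_concat:
  "path_between X p q f \<Longrightarrow> path_between X q r g \<Longrightarrow> path_between X p r (concat_loops f g)"
  using pathin_concat[of X f g] by (auto simp: path_between_def concat_loops_def)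

lemma path_mult_closed:
  "A \<in> path_classes X p q \<Longrightarrow> B \<in> path_classes X q r \<Longrightarrow> path_mult X A B \<in> path_classes X p r"
  by (auto simp: path_classes_def path_mult_class path_between_concat)

lemma path_mult_assoc:
  assumes "A \<in> path_classes X p q" "B \<in> path_classes X q r" "C \<in> path_classes X r s"
  shows "path_mult X (path_mult X A B) C = path_mult X A (path_mult X B C)"
proof -
  obtain f g h where fgh: "path_between X p q f" "path_between X q r g" "path_between X r s h"
      "A = path_class X f" "B = path_class X g" "C = path_class X h"
    using assms by (auto simp: path_classes_def)
  have l: "path_between X p s (concat_loops f (concat_loops g h))"
    by (rule path_between_concat[OF fgh(1) path_between_concat[OF fgh(2,3)]])
  \<comment> \<open>One bracketing changes path at 1/4 and 1/2, the other at 1/2 and 3/4;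
    \<open>\<alpha>\<close> is the piecewise linear map between these partitions.\<close>
  define \<alpha> :: "real \<Rightarrow> real" where
    "\<alpha> = (\<lambda>t. if t \<le> 1/2 then (if t \<le> 1/4 then 2 * t else t + 1/4) else t / 2 + 1/2)"
  have "continuous_on {0..1} (\<lambda>t::real. if t \<le> 1/4 then 2 * t else t + 1/4)"
    by (intro continuous_on_cases_le continuous_intros) auto
  then have \<alpha>: "continuous_on {0..1} \<alpha>"
    unfolding \<alpha>_def by (intro continuous_on_cases_le continuous_intros continuous_on_subset[of "{0..1}"]) auto
  have "path_homotopic X (concat_loops (concat_loops f g) h) (concat_loops f (concat_loops g h))"
    by (rule path_homotopic_reparam[of X "concat_loops f (concat_loops g h)" \<alpha> "\<lambda>t. t"])
       (use l \<alpha> in \<open>auto simp: \<alpha>_def path_between_def concat_loops_def algebra_simps\<close>)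
  from path_class_eq[OF this] show ?thesis
    using fgh path_mult_class[OF fgh(1,2)] path_mult_class[OF fgh(2,3)]
      path_mult_class[OF path_between_concat[OF fgh(1,2)] fgh(3)]
      path_mult_class[OF fgh(1) path_between_concat[OF fgh(2,3)]] by simp
qed

lemma path_class_in_path_classes: "path_between X p q f \<Longrightarrow> path_class X f \<in> path_classes X p q"
  by (simp add: path_classes_def)

lemma path_between_const: "p \<in> topspace X \<Longrightarrow> path_between X p p (\<lambda>_. p)"
  by (simp add: path_between_def pathin_def)

lemma path_classes_topspace:
  "A \<in> path_classes X p q \<Longrightarrow> p \<in> topspace X \<and> q \<in> topspace X"
  by (auto simp: path_classes_def path_between_def pathin_def continuous_map_def Pi_iff)

lemma path_mult_one:
  assumes "A \<in> path_classes X p q"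
  shows "path_mult X (path_class X (\<lambda>_. p)) A = A" "path_mult X A (path_class X (\<lambda>_. q)) = A"
proof -
  obtain f where f: "path_between X p q f" "A = path_class X f"
    using assms by (auto simp: path_classes_def)
  have pq: "path_between X p p (\<lambda>_. p)" "path_between X q q (\<lambda>_. q)"
    using path_classes_topspace[OF assms] by (simp_all add: path_between_const)
  have 1: "continuous_on {0..1} (\<lambda>t::real. max 0 (2 * t - 1))" by (intro continuous_intros)
  have "path_homotopic X (concat_loops (\<lambda>_. p) f) f"
    by (rule path_homotopic_reparam[of X f "\<lambda>t. max 0 (2 * t - 1)" "\<lambda>t. t"])
       (use f 1 in \<open>auto simp: path_between_def concat_loops_def max_absorb1 max_absorb2\<close>)
  then show "path_mult X (path_class X (\<lambda>_. p)) A = A"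
    using f pq by (simp add: path_mult_class path_class_eq)
  have 2: "continuous_on {0..1} (\<lambda>t::real. min 1 (2 * t))" by (intro continuous_intros)
  have "path_homotopic X (concat_loops f (\<lambda>_. q)) f"
    by (rule path_homotopic_reparam[of X f "\<lambda>t. min 1 (2 * t)" "\<lambda>t. t"])
       (use f 2 in \<open>auto simp: path_between_def concat_loops_def min_absorb1 min_absorb2\<close>)
  then show "path_mult X A (path_class X (\<lambda>_. q)) = A"
    using f pq by (simp add: path_mult_class path_class_eq)
qed

lemma path_mult_inverse:
  assumes "A \<in> path_classes X p q"
  obtains B where "B \<in> path_classes X q p" "path_mult X A B = path_class X (\<lambda>_. p)"
    "path_mult X B A = path_class X (\<lambda>_. q)"
proof -
  have inv: "path_homotopic X (concat_loops (\<lambda>t. f (1 - t)) f) (\<lambda>_. q)"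
    if "path_between X p q f" for p q f
  proof -
    \<comment> \<open>The reversed path followed by \<open>f\<close> is \<open>f\<close> at this
      folded parameter, which contracts to the constant 1.\<close>
    have "continuous_on {0..1} (\<lambda>t::real. \<bar>1 - 2 * t\<bar>)" by (intro continuous_intros)
    then show ?thesis
      by (intro path_homotopic_reparam[of X f "\<lambda>t. \<bar>1 - 2 * t\<bar>" "\<lambda>t. 1"])
         (use that in \<open>auto simp: path_between_def concat_loops_def abs_if\<close>)
  qed
  obtain f where f: "path_between X p q f" "A = path_class X f"
    using assms by (auto simp: path_classes_def)
  define g where "g = (\<lambda>t. f (1 - t))"
  have "path_homotopic X g g"
    by (rule path_homotopic_reparam[of X f "\<lambda>t. 1 - t" "\<lambda>t. 1 - t"])
       (use f in \<open>auto simp: path_between_def g_def intro!: continuous_intros\<close>)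
  then have g: "path_between X q p g"
    using f by (auto simp: path_between_def g_def path_homotopic_refl)
  have "f = (\<lambda>t. g (1 - t))" by (simp add: g_def)
  then have "path_homotopic X (concat_loops f g) (\<lambda>_. p)" "path_homotopic X (concat_loops g f) (\<lambda>_. q)"
    using inv[OF f(1)] inv[OF g] by (simp_all add: g_def)
  then show ?thesis
    using that[of "path_class X g"] f g by (simp add: path_mult_class path_class_in_path_classes path_class_eq)
qed

section \<open>Functoriality under continuous maps\<close>

lemma path_map_class:
  assumes "continuous_map X Y \<psi>" "pathin X f"
  shows "path_map Y \<psi> (path_class X f) = path_class Y (\<psi> \<circ> f)"
proof -
  have "path_homotopic Y (\<psi> \<circ> f) (\<psi> \<circ> g)" if "path_homotopic X f g" for g
    using that unfolding path_homotopic_def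
    by (rule homotopic_with_compose_continuous_map_left) (use assms in auto)
  then have "path_class Y (\<psi> \<circ> g) = path_class Y (\<psi> \<circ> f)" if "g \<in> path_class X f" for g
    using that path_class_eq[of Y "\<psi> \<circ> f" "\<psi> \<circ> g"] by (auto simp: path_class_def)
  then show ?thesis
    using path_class_self[OF assms(2)] unfolding path_map_def by blast
qed

lemma path_map_closed:
  assumes "continuous_map X Y \<psi>" "A \<in> path_classes X p q"
  shows "path_map Y \<psi> A \<in> path_classes Y (\<psi> p) (\<psi> q)"
  using assms pathin_compose[OF _ assms(1)]
  by (auto simp: path_classes_def path_between_def path_map_class intro!: imageI)

lemma path_map_mult:
  assumes "continuous_map X Y \<psi>" "A \<in> path_classes X p q" "B \<in> path_classes X q r"
  shows "path_map Y \<psi> (path_mult X A B) = path_mult Y (path_map Y \<psi> A) (path_map Y \<psi> B)"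
proof -
  obtain f g where fg: "path_between X p q f" "path_between X q r g" "A = path_class X f" "B = path_class X g"
    using assms by (auto simp: path_classes_def)
  then have "path_between Y (\<psi> p) (\<psi> q) (\<psi> \<circ> f)" "path_between Y (\<psi> q) (\<psi> r) (\<psi> \<circ> g)"
    using pathin_compose[OF _ assms(1)] by (auto simp: path_between_def)
  moreover have "\<psi> \<circ> concat_loops f g = concat_loops (\<psi> \<circ> f) (\<psi> \<circ> g)"
    by (auto simp: concat_loops_def)
  moreover have "pathin X f" "pathin X g" "pathin X (concat_loops f g)"
    using fg path_between_concat[OF fg(1,2)] by (auto simp: path_between_def)
  ultimately show ?thesis
    using fg by (simp add: path_mult_class path_map_class[OF assms(1)])
qed

section \<open>Comparison with the fundamental group\<close>

lemma loop_class_eq_path_class: "loop_at X x f \<Longrightarrow> loop_class X x f = path_class X f"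
  by (auto simp: loop_class_def path_class_def path_homotopic_def homotopic_loops_at_def loop_at_def)

lemma loop_at_eq_path_between: "loop_at X x = path_between X x x"
  by (simp add: fun_eq_iff loop_at_def path_between_def)

lemma carrier_fundamental_group_eq: "carrier (fundamental_group X x) = path_classes X x x"
  using loop_class_eq_path_class[of X x]
  by (auto simp: fundamental_group_def path_classes_def loop_at_eq_path_between)

lemma mult_fundamental_group_eq:
  assumes "A \<in> path_classes X x x" "B \<in> path_classes X x x"
  shows "A \<otimes>\<^bsub>fundamental_group X x\<^esub> B = path_mult X A B"
proof -
  obtain f g where fg: "path_between X x x f" "path_between X x x g" "A = path_class X f" "B = path_class X g"
    using assms by (auto simp: path_classes_def)
  show ?thesis
    using fg mult_fundamental_group[of X x f g] path_between_concat[OF fg(1,2)]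
    by (simp add: loop_at_eq_path_between path_mult_class loop_class_eq_path_class)
qed

lemma one_fundamental_group_eq:
  "x \<in> topspace X \<Longrightarrow> \<one>\<^bsub>fundamental_group X x\<^esub> = path_class X (\<lambda>_. x)"
  by (simp add: fundamental_group_def loop_class_eq_path_class loop_at_eq_path_between path_between_const)

lemma fundamental_group_map_eq:
  assumes "continuous_map X Y \<psi>" "A \<in> path_classes X x x"
  shows "fundamental_group_map x Y \<psi> A = path_map Y \<psi> A"
proof -
  obtain f where f: "loop_at X x f" "A = path_class X f"
    using assms(2) by (auto simp: path_classes_def loop_at_eq_path_between)
  moreover have "loop_at Y (\<psi> x) (\<psi> \<circ> f)"
    using f(1) pathin_compose[OF _ assms(1)] by (auto simp: loop_at_def)
  ultimately show ?thesis
    using fundamental_group_map_loop_class[OF assms(1) f(1)] path_map_class[OF assms(1), of f]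
    by (simp add: loop_class_eq_path_class loop_at_def)
qed

text \<open>The return path \<open>B'\<close> and the next departure \<open>B\<close> cancel. This
  is the computation behind the multiplicativity of holonomy on a triangle.\<close>

lemma path_mult_conj:
  assumes "A \<in> path_classes X y p" "a \<in> path_classes X p q" "B' \<in> path_classes X q y"
    and "B \<in> path_classes X y q" "b \<in> path_classes X q r" "C \<in> path_classes X r y"
    and "path_mult X B' B = path_class X (\<lambda>_. q)"
  shows "path_mult X (path_mult X (path_mult X A a) B') (path_mult X (path_mult X B b) C)
    = path_mult X (path_mult X A (path_mult X a b)) C"
proof -
  let ?m = "path_mult X"
  have Aa: "?m A a \<in> path_classes X y q" and bC: "?m b C \<in> path_classes X q y"
    using assms path_mult_closed by metis+
  have "?m (?m (?m A a) B') (?m (?m B b) C) = ?m (?m A a) (?m B' (?m B (?m b C)))"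
    using path_mult_assoc[OF Aa assms(3) path_mult_closed[OF assms(4) bC]] path_mult_assoc[OF assms(4,5,6)] by simp
  also have "?m B' (?m B (?m b C)) = ?m b C"
    using path_mult_assoc[OF assms(3,4) bC] assms(7) path_mult_one(1)[OF bC] by simp
  also have "?m (?m A a) (?m b C) = ?m (?m A (?m a b)) C"
    using path_mult_assoc[OF Aa assms(5,6)] path_mult_assoc[OF assms(1,2,5)] by simp
  finally show ?thesis .
qed

subsection \<open>Singular simplices and paths\<close>

definition edge_point :: "real \<Rightarrow> nat \<Rightarrow> real" where
  "edge_point t = (\<lambda>j. if j = 0 then 1 - t else if j = 1 then t else 0)"

text \<open>Singular simplices are extensional functions, hence the \<open>restrict\<close>; the
  coordinate \<open>a 1\<close> inverts \<open>edge_point\<close>.\<close>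

definition simplex_of_path :: "(real \<Rightarrow> 'a) \<Rightarrow> (nat \<Rightarrow> real) \<Rightarrow> 'a" where
  "simplex_of_path f = restrict (\<lambda>a. f (a 1)) (standard_simplex 1)"

definition edge_class :: "'a topology \<Rightarrow> ((nat \<Rightarrow> real) \<Rightarrow> 'a) \<Rightarrow> (real \<Rightarrow> 'a) set" where
  "edge_class X \<sigma> = path_class X (\<sigma> \<circ> edge_point)"

lemma edge_point_in_simplex: "t \<in> {0..1} \<Longrightarrow> edge_point t \<in> standard_simplex 1"
  by (auto simp: edge_point_def standard_simplex_def atMost_Suc)

lemma standard_simplex_1_coord: "a \<in> standard_simplex 1 \<Longrightarrow> a 1 \<in> {0..1}"
  by (auto simp: standard_simplex_def)

text \<open>The vertex of the 0-simplex and the initial vertex of the 1-simplex are the same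
  coordinate sequence, so \<open>edge_point 0\<close> serves in both roles.\<close>

lemma edge_point_0: "standard_simplex 0 = {edge_point 0}"
  by (auto simp: standard_simplex_0 edge_point_def fun_eq_iff)

lemma edge_point_coord: "edge_point t (Suc 0) = t"
  by (simp add: edge_point_def)

lemma continuous_map_simplex_coord:
  "continuous_map (subtopology (powertop_real UNIV) S) euclideanreal (\<lambda>a. a i)"
  by (intro continuous_map_from_subtopology continuous_map_product_projection UNIV_I)

lemma path_between_edge:
  assumes "singular_simplex 1 X \<sigma>"
  shows "path_between X (\<sigma> (edge_point 0)) (\<sigma> (edge_point 1)) (\<sigma> \<circ> edge_point)"
proof -
  have "continuous_map (top_of_set {0..1}) euclideanreal (\<lambda>t. edge_point t j)" for j
    by (cases "j = 0"; cases "j = 1") (auto simp: edge_point_def intro!: continuous_intros)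
  then have "continuous_map (top_of_set {0..1}) (powertop_real UNIV) edge_point"
    unfolding continuous_map_componentwise_UNIV by blast
  then have "continuous_map (top_of_set {0..1}) (subtopology (powertop_real UNIV) (standard_simplex 1)) edge_point"
    using edge_point_in_simplex by (auto simp: continuous_map_in_subtopology)
  from continuous_map_compose[OF this] show ?thesis
    using assms by (auto simp: path_between_def pathin_def singular_simplex_def)
qed

lemma edge_class_in_path_classes:
  "singular_simplex 1 X \<sigma> \<Longrightarrow> edge_class X \<sigma> \<in> path_classes X (\<sigma> (edge_point 0)) (\<sigma> (edge_point 1))"
  unfolding edge_class_def by (intro path_class_in_path_classes path_between_edge)

lemma singular_simplex_of_path:
  assumes "pathin X f"
  shows "singular_simplex 1 X (simplex_of_path f)"
proof -
  have "continuous_map (subtopology (powertop_real UNIV) (standard_simplex 1)) euclideanreal (\<lambda>a. a 1)"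
    by (rule continuous_map_simplex_coord)
  then have "continuous_map (subtopology (powertop_real UNIV) (standard_simplex 1)) (top_of_set {0..1}) (\<lambda>a. a 1)"
    using standard_simplex_1_coord by (auto simp: continuous_map_in_subtopology)
  from continuous_map_compose[OF this assms[unfolded pathin_def]] show ?thesis
    unfolding singular_simplex_def simplex_of_path_def
    by (auto simp: o_def elim: continuous_map_eq)
qed

lemma simplex_of_path_edge_point: "t \<in> {0..1} \<Longrightarrow> simplex_of_path f (edge_point t) = f t"
  using edge_point_in_simplex[of t] by (simp add: simplex_of_path_def edge_point_coord)

lemma path_class_cong:
  assumes "pathin X f" "\<And>t. t \<in> {0..1} \<Longrightarrow> g t = f t"
  shows "path_class X g = path_class X f"
  by (rule path_class_eq[OF path_homotopic_reparam[of X f "\<lambda>t. t" "\<lambda>t. t"]]) (use assms in auto)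

lemma edge_class_simplex_of_path:
  "pathin X f \<Longrightarrow> edge_class X (simplex_of_path f) = path_class X f"
  unfolding edge_class_def by (rule path_class_cong) (simp_all add: simplex_of_path_edge_point)

lemma simplex_map_simplex_of_path: "simplex_map 1 \<psi> (simplex_of_path f) = simplex_of_path (\<psi> \<circ> f)"
  by (auto simp: simplex_map_def simplex_of_path_def fun_eq_iff)

lemma path_map_edge_class:
  assumes "continuous_map X Y \<psi>" "singular_simplex 1 X \<sigma>"
  shows "path_map Y \<psi> (edge_class X \<sigma>) = edge_class Y (simplex_map 1 \<psi> \<sigma>)"
proof -
  have \<sigma>: "pathin X (\<sigma> \<circ> edge_point)"
    using path_between_edge[OF assms(2)] by (simp add: path_between_def)
  have "path_class Y (simplex_map 1 \<psi> \<sigma> \<circ> edge_point) = path_class Y (\<psi> \<circ> (\<sigma> \<circ> edge_point))"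
    by (rule path_class_cong) (use edge_point_in_simplex pathin_compose[OF \<sigma> assms(1)] in \<open>auto simp: simplex_map_def\<close>)
  then show ?thesis
    unfolding edge_class_def path_map_class[OF assms(1) \<sigma>] by simp
qed

section \<open>Triangles and their edges\<close>

lemma singular_face_edge_point:
  assumes "t \<in> {0..1}"
  shows "singular_face 2 k \<tau> (edge_point t) = \<tau> (simplical_face k (edge_point t))"
  using edge_point_in_simplex[OF assms] by (simp add: singular_face_def)

lemma simplical_face_edge_point:
  "simplical_face 0 (edge_point 1) = simplical_face 1 (edge_point 1)"
  "simplical_face 2 (edge_point 1) = simplical_face 0 (edge_point 0)"
  "simplical_face 2 (edge_point 0) = simplical_face 1 (edge_point 0)"
  by (auto simp: simplical_face_def edge_point_def fun_eq_iff)

lemma singular_face_2_vertices: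
  "singular_face 2 0 \<tau> (edge_point 1) = singular_face 2 1 \<tau> (edge_point 1)"
  "singular_face 2 2 \<tau> (edge_point 1) = singular_face 2 0 \<tau> (edge_point 0)"
  "singular_face 2 2 \<tau> (edge_point 0) = singular_face 2 1 \<tau> (edge_point 0)"
  by (simp_all add: singular_face_edge_point simplical_face_edge_point)

lemma singular_face_1_edge_point:
  "singular_face 1 0 \<sigma> (edge_point 0) = \<sigma> (edge_point 1)"
  "singular_face 1 1 \<sigma> (edge_point 0) = \<sigma> (edge_point 0)"
proof -
  have "simplical_face 0 (edge_point 0) = edge_point 1" "simplical_face 1 (edge_point 0) = edge_point 0"
    by (auto simp: simplical_face_def edge_point_def fun_eq_iff)
  then show "singular_face 1 0 \<sigma> (edge_point 0) = \<sigma> (edge_point 1)"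
      "singular_face 1 1 \<sigma> (edge_point 0) = \<sigma> (edge_point 0)"
    by (simp_all add: singular_face_def edge_point_0)
qed

text \<open>The standard triangle is convex, so inside it the way along 01 and 12 deforms to 02 with
  fixed ends.\<close>

lemma edge_class_mult:
  assumes "singular_simplex 2 X \<tau>"
  shows "path_mult X (edge_class X (singular_face 2 2 \<tau>)) (edge_class X (singular_face 2 0 \<tau>))
    = edge_class X (singular_face 2 1 \<tau>)"
proof -
  \<comment> \<open>A planar copy of the standard 2-simplex in the coordinates 1 and 2. The
    straight-line homotopy takes place in this subset of a normed space, and \<open>T\<close>
    carries it to coordinate sequences.\<close>
  define S where "S = {p::real \<times> real. 0 \<le> fst p \<and> 0 \<le> snd p \<and> fst p + snd p \<le> 1}"
  define T where "T = (\<lambda>p::real \<times> real. \<lambda>j::nat.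
    if j = 0 then 1 - fst p - snd p else if j = 1 then fst p else if j = 2 then snd p else 0)"
  have "S = {p. (-1, 0) \<bullet> p \<le> 0} \<inter> {p. (0, -1) \<bullet> p \<le> 0} \<inter> {p. (1, 1) \<bullet> p \<le> 1}"
    by (auto simp: S_def inner_prod_def)
  then have S: "convex S"
    by (metis convex_Int convex_halfspace_le)
  have "continuous_map (top_of_set S) euclideanreal (\<lambda>p. T p j)" for j
    by (cases "j = 0"; cases "j = 1"; cases "j = 2") (auto simp: T_def intro!: continuous_intros)
  then have "continuous_map (top_of_set S) (powertop_real UNIV) T"
    unfolding continuous_map_componentwise_UNIV by blast
  moreover have "T ` S \<subseteq> standard_simplex 2"
    by (auto simp: S_def T_def standard_simplex_def atMost_Suc numeral_2_eq_2)
  ultimately have "continuous_map (top_of_set S) (subtopology (powertop_real UNIV) (standard_simplex 2)) T"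
    by (auto simp: continuous_map_in_subtopology)
  from continuous_map_compose[OF this] have F: "continuous_map (top_of_set S) X (\<tau> \<circ> T)"
    using assms unfolding singular_simplex_def by blast
  have sf: "singular_simplex 1 X (singular_face 2 i \<tau>)" if "i \<le> 2" for i
    using singular_simplex_singular_face[OF assms, of i] that by simp
  have T2: "simplical_face 2 (edge_point t) = T (t, 0)"
    and T0: "simplical_face 0 (edge_point t) = T (1 - t, t)"
    and T1: "simplical_face 1 (edge_point t) = T (0, t)" for t
    by (auto simp: simplical_face_def edge_point_def T_def fun_eq_iff)
  let ?f = "\<lambda>i. singular_face 2 i \<tau> \<circ> edge_point"
  have "path_homotopic X (concat_loops (?f 2) (?f 0)) (?f 1)"
  proof (rule path_homotopic_convex[OF S F])
    \<comment> \<open>The broken line from (0, 0) over (1, 0) to (0, 1), written with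
      \<open>min\<close> and \<open>max\<close> to make it one visibly continuous formula.\<close>
    show "continuous_on {0..1} (\<lambda>t::real. (min (2 * t) (2 - 2 * t), max 0 (2 * t - 1)))"
      by (intro continuous_intros)
    show "(min (2 * t) (2 - 2 * t), max 0 (2 * t - 1)) \<in> S" if "t \<in> {0..1}" for t :: real
      using that by (auto simp: S_def)
    show "continuous_on {0..1} (\<lambda>t::real. (0::real, t))"
      by (intro continuous_intros)
    show "(0, t) \<in> S" if "t \<in> {0..1}" for t :: real
      using that by (auto simp: S_def)
    show "?f 1 t = (\<tau> \<circ> T) (0, t)" if "t \<in> {0..1}" for t
      using singular_face_edge_point[OF that, of 1 \<tau>] T1[of t] by simp
    show "concat_loops (?f 2) (?f 0) t = (\<tau> \<circ> T) (min (2 * t) (2 - 2 * t), max 0 (2 * t - 1))"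
      if "t \<in> {0..1}" for t
    proof (cases "t \<le> 1/2")
      case True
      then have "min (2 * t) (2 - 2 * t) = 2 * t" "max 0 (2 * t - 1) = 0"
        by auto
      then show ?thesis
        using that True by (simp add: concat_loops_def singular_face_edge_point T2)
    next
      case False
      then have "min (2 * t) (2 - 2 * t) = 2 - 2 * t" "max 0 (2 * t - 1) = 2 * t - 1"
        by auto
      then show ?thesis
        using that False by (simp add: concat_loops_def singular_face_edge_point T0)
    qed
  qed auto
  from path_class_eq[OF this] show ?thesis
    unfolding edge_class_def
    using path_mult_class[OF path_between_edge[OF sf, of 2] path_between_edge[OF sf, of 0, folded singular_face_2_vertices(2)]]
    by simp
qed

text \<open>A null-homotopy is constant on three sides of its square. Composed with a map from the
  triangle to the square, it gives a simplex with the loop on the edge 01 and constants on the other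
  two edges. These cancel in the boundary, so the simplex acts as a disc bounded by the
  loop.\<close>

lemma cone_simplex_exists:
  assumes f: "path_homotopic Y f (\<lambda>_. y)" "f 0 = y" "f 1 = y"
  obtains D where "singular_simplex 2 Y D" "singular_face 2 2 D = simplex_of_path f"
    "singular_face 2 0 D = singular_face 2 1 D"
proof -
  obtain h where h: "continuous_map (prod_topology (top_of_set {0..1::real}) (top_of_set {0..1::real})) Y h"
      "\<forall>t\<in>{0..1}. h (0, t) = f t" "\<forall>t\<in>{0..1}. h (1, t) = y" "\<forall>s\<in>{0..1}. h (s, 0) = y \<and> h (s, 1) = y"
    using f unfolding path_homotopic_iff by auto
  let ?Z = "subtopology (powertop_real UNIV) (standard_simplex 2)"
  \<comment> \<open>The polar coordinates of the disc; the clamps replace \<open>a 1 / (a 0 + a 1)\<close>, which is singular at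
    the cone point \<open>a 2 = 1\<close>, and are harmless because \<open>h\<close> is constant where they act.\<close>
  define r where "r = (\<lambda>a::nat \<Rightarrow> real. (min 1 (2 * a 2), a 1 / max (1/2) (1 - a 2)))"
  have coord: "continuous_map ?Z euclideanreal (\<lambda>a. a i)" for i
    by (rule continuous_map_simplex_coord)
  have simp2: "0 \<le> a 0" "0 \<le> a 1" "0 \<le> a 2" "a 0 + a 1 + a 2 = 1" if "a \<in> standard_simplex 2" for a
    using that by (auto simp: standard_simplex_def atMost_Suc numeral_2_eq_2)
  have r01: "fst (r a) \<in> {0..1}" "snd (r a) \<in> {0..1}" if "a \<in> standard_simplex 2" for a
    using simp2[OF that] by (auto simp: r_def divide_simps max_def)
  have nz: "max (1/2) z \<noteq> 0" for z :: real
    by (simp add: max_def)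
  have "continuous_map ?Z euclideanreal (fst \<circ> r)" "continuous_map ?Z euclideanreal (snd \<circ> r)"
    unfolding r_def o_def fst_conv snd_conv
    by (auto intro!: continuous_map_real_min continuous_map_real_max continuous_map_real_mult
        continuous_map_real_divide continuous_map_diff coord simp: nz)
  then have "continuous_map ?Z (prod_topology (top_of_set {0..1}) (top_of_set {0..1})) r"
    unfolding continuous_map_pairwise using r01 by (auto simp: continuous_map_in_subtopology)
  from continuous_map_compose[OF this h(1)]
  have D: "singular_simplex 2 Y (restrict (h \<circ> r) (standard_simplex 2))"
    unfolding singular_simplex_def by (auto elim: continuous_map_eq)
  have face: "simplical_face k a \<in> standard_simplex 2" if "a \<in> standard_simplex 1" "k \<le> 2" for k a
    using simplical_face_in_standard_simplex[of 2 k a] that by simp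
  have *: "0 \<le> a 0" "0 \<le> a 1" "a 0 = 1 - a 1" if "a \<in> standard_simplex 1" for a
    using that by (auto simp: standard_simplex_def atMost_Suc)
  show ?thesis
  proof (rule that[OF D])
    show "singular_face 2 2 (restrict (h \<circ> r) (standard_simplex 2)) = simplex_of_path f"
    proof
      fix a show "singular_face 2 2 (restrict (h \<circ> r) (standard_simplex 2)) a = simplex_of_path f a"
        using face[of a 2] h(2) *[of a]
        by (auto simp: singular_face_def simplex_of_path_def restrict_def simplical_face_def r_def max_def)
    qed
    show "singular_face 2 0 (restrict (h \<circ> r) (standard_simplex 2)) = singular_face 2 1 (restrict (h \<circ> r) (standard_simplex 2))"
    proof
      fix a
      have "h (r (simplical_face 0 a)) = y" "h (r (simplical_face 1 a)) = y" if a: "a \<in> standard_simplex 1"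
      proof -
        \<comment> \<open>The second coordinate is 1 as long as its denominator is not clamped;
          beyond that the first coordinate has reached 1.\<close>
        have "fst (r (simplical_face 0 a)) = 1 \<or> snd (r (simplical_face 0 a)) = 1"
          using *[OF a] by (auto simp: r_def simplical_face_def max_def min_def)
        then show "h (r (simplical_face 0 a)) = y"
          using r01[OF face[OF a, of 0]] h(3,4) by (metis prod.collapse zero_le)
        have "snd (r (simplical_face 1 a)) = 0"
          by (simp add: r_def simplical_face_def)
        then show "h (r (simplical_face 1 a)) = y"
          using r01[OF face[OF a, of 1]] h(4) by (metis prod.collapse one_le_numeral)
      qed
      then show "singular_face 2 0 (restrict (h \<circ> r) (standard_simplex 2)) a
          = singular_face 2 1 (restrict (h \<circ> r) (standard_simplex 2)) a"
        using face[of a 0] face[of a 1] by (auto simp: singular_face_def restrict_def)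
    qed
  qed
qed

text \<open>Injectivity on H_0: a path in \<open>Y\<close> makes the difference of the image points
  a boundary, hence the difference of the points is one in \<open>X\<close>, and the augmentation
  over a single path component detects this.\<close>

lemma integral_homology_equivalence_path_component:
  assumes \<psi>: "integral_homology_equivalence X Y \<psi>" and x: "x \<in> topspace X" "x' \<in> topspace X"
    and "path_component_of Y (\<psi> x) (\<psi> x')"
  shows "path_component_of X x x'"
proof -
  define pt where "pt = (\<lambda>z::'a. restrict (\<lambda>_. z) (standard_simplex 0))"
  obtain f where f: "pathin Y f" "f 0 = \<psi> x" "f 1 = \<psi> x'"
    using assms(4) by (auto simp: path_component_of_def)
  have pt: "singular_simplex 0 X (pt z)" if "z \<in> topspace X" for z
    using that by (simp add: singular_simplex_def pt_def)
  have "singular_relboundary 0 X {} (frag_of (pt x') - frag_of (pt x))"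
  proof (rule integral_homology_equivalence_inj[OF \<psi>])
    show "singular_relcycle 0 X {} (frag_of (pt x') - frag_of (pt x))"
      using pt x by (simp add: singular_cycle singular_chain_of singular_chain_diff chain_boundary_def)
    \<comment> \<open>Simplices of dimension 0 are extensional over one point, so a single value
      decides their equality.\<close>
    have "singular_face 1 i (simplex_of_path f) a = simplex_map 0 \<psi> (pt z) a"
      if "singular_face 1 i (simplex_of_path f) (edge_point 0) = \<psi> z" for i z a
      using that by (cases "a = edge_point 0") (auto simp: singular_face_def simplex_map_def pt_def edge_point_0)
    then have "singular_face 1 0 (simplex_of_path f) = simplex_map 0 \<psi> (pt x')"
        "singular_face 1 1 (simplex_of_path f) = simplex_map 0 \<psi> (pt x)"
      using f by (auto simp only: fun_eq_iff singular_face_1_edge_point simplex_of_path_edge_point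
          atLeastAtMost_iff order_refl zero_le_one)
    then show "singular_relboundary 0 Y {} (chain_map 0 \<psi> (frag_of (pt x') - frag_of (pt x)))"
      unfolding singular_boundary using singular_simplex_of_path[OF f(1)]
      by (intro exI[of _ "frag_of (simplex_of_path f)"])
         (simp add: singular_chain_of chain_boundary_1 chain_map_diff)
  qed
  then obtain d where d: "singular_chain (Suc 0) X d" "chain_boundary (Suc 0) d = frag_of (pt x') - frag_of (pt x)"
    unfolding singular_boundary by auto
  \<comment> \<open>The augmentation on the path component of \<open>x\<close>.\<close>
  define \<epsilon> where "\<epsilon> = frag_extend (\<lambda>\<sigma>. if path_component_of X x (\<sigma> (edge_point 0)) then frag_of () else 0)"
  have "\<epsilon> (chain_boundary (Suc 0) d) = 0"
    using d(1) unfolding singular_chain_def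
  proof (induction d rule: frag_induction)
    case (one \<sigma>)
    then have "path_component_of X (\<sigma> (edge_point 0)) (\<sigma> (edge_point 1))"
      using path_between_edge[of X \<sigma>] unfolding path_component_of_def path_between_def by auto
    then have "path_component_of X x (\<sigma> (edge_point 0)) \<longleftrightarrow> path_component_of X x (\<sigma> (edge_point 1))"
      by (meson path_component_of_sym path_component_of_trans)
    then show ?case
      using singular_face_1_edge_point[of \<sigma>] by (simp add: \<epsilon>_def chain_boundary_1 frag_extend_diff)
  qed (auto simp: \<epsilon>_def chain_boundary_diff frag_extend_diff)
  \<comment> \<open>The point \<open>x\<close> contributes with a minus sign, and \<open>x'\<close>
    can compensate for it only from the same path component.\<close>
  then show ?thesis
    using x by (auto simp: d(2) \<epsilon>_def frag_extend_diff pt_def edge_point_0 path_component_of_refl split: if_splits)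
qed

subsection \<open>Holonomy of singular edges\<close>

text \<open>A path from the base point to every point of its component, with the inverse class kept
  as separate data. Nothing normalises \<open>l x\<close>, so the holonomy of a loop at
  \<open>x\<close> is its class up to conjugation.\<close>

definition base_paths :: "'a topology \<Rightarrow> 'a \<Rightarrow> ('a \<Rightarrow> (real \<Rightarrow> 'a) set) \<Rightarrow> ('a \<Rightarrow> (real \<Rightarrow> 'a) set) \<Rightarrow> bool" where
  "base_paths X x l l' \<longleftrightarrow> (\<forall>p. path_component_of X x p \<longrightarrow>
     l p \<in> path_classes X x p \<and> l' p \<in> path_classes X p x \<and>
     path_mult X (l p) (l' p) = path_class X (\<lambda>_. x) \<and> path_mult X (l' p) (l p) = path_class X (\<lambda>_. p))"

text \<open>The value outside the path component of the base point is chosen only to keep the holonomy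
  multiplicative; compatibility with \<open>\<psi>\<close> there needs injectivity on path components.\<close>

definition edge_holonomy ::
    "'a topology \<Rightarrow> 'a \<Rightarrow> ('a \<Rightarrow> (real \<Rightarrow> 'a) set) \<Rightarrow> ('a \<Rightarrow> (real \<Rightarrow> 'a) set)
      \<Rightarrow> ((nat \<Rightarrow> real) \<Rightarrow> 'a) \<Rightarrow> (real \<Rightarrow> 'a) set" where
  "edge_holonomy X x l l' \<sigma> =
     (if path_component_of X x (\<sigma> (edge_point 0))
      then path_mult X (path_mult X (l (\<sigma> (edge_point 0))) (edge_class X \<sigma>)) (l' (\<sigma> (edge_point 1)))
      else path_class X (\<lambda>_. x))"

lemma path_component_of_edge:
  "singular_simplex 1 X \<sigma> \<Longrightarrow> path_component_of X (\<sigma> (edge_point 0)) (\<sigma> (edge_point 1))"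
  using path_between_edge[of X \<sigma>] unfolding path_component_of_def path_between_def by blast

lemma base_paths_exists: "\<exists>l l'. base_paths X x l l'"
proof -
  have "\<exists>A B. A \<in> path_classes X x p \<and> B \<in> path_classes X p x \<and>
     path_mult X A B = path_class X (\<lambda>_. x) \<and> path_mult X B A = path_class X (\<lambda>_. p)"
    if p: "path_component_of X x p" for p
  proof -
    obtain f where "path_between X x p f"
      using p by (auto simp: path_component_of_def path_between_def)
    then have A: "path_class X f \<in> path_classes X x p"
      by (rule path_class_in_path_classes)
    obtain B where "B \<in> path_classes X p x" "path_mult X (path_class X f) B = path_class X (\<lambda>_. x)"
        "path_mult X B (path_class X f) = path_class X (\<lambda>_. p)"
      using path_mult_inverse[OF A] .
    with A show ?thesis by blast
  qed
  then show ?thesis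
    unfolding base_paths_def by metis
qed

text \<open>Surjectivity on fundamental groups allows an arbitrary path to be corrected by a loop
  until its image is the prescribed class. Strictly matching base paths are what makes holonomy
  commute with \<open>\<psi>\<close>.\<close>

lemma base_paths_lift:
  assumes \<psi>: "continuous_map X Y \<psi>" and x: "x \<in> topspace X"
    and epi: "fundamental_group_map x Y \<psi> \<in> epi (fundamental_group X x) (fundamental_group Y (\<psi> x))"
    and m: "base_paths Y (\<psi> x) m m'"
  shows "\<exists>l l'. base_paths X x l l' \<and>
    (\<forall>p. path_component_of X x p \<longrightarrow> path_map Y \<psi> (l p) = m (\<psi> p) \<and> path_map Y \<psi> (l' p) = m' (\<psi> p))"
proof -
  let ?y = "\<psi> x"
  have "\<exists>A B. A \<in> path_classes X x p \<and> B \<in> path_classes X p x \<and>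
     path_mult X A B = path_class X (\<lambda>_. x) \<and> path_mult X B A = path_class X (\<lambda>_. p) \<and>
     path_map Y \<psi> A = m (\<psi> p) \<and> path_map Y \<psi> B = m' (\<psi> p)"
    if p: "path_component_of X x p" for p
  proof -
    obtain k k' where "base_paths X x k k'"
      using base_paths_exists[of X x] by blast
    then have k: "k p \<in> path_classes X x p" "k' p \<in> path_classes X p x"
        "path_mult X (k p) (k' p) = path_class X (\<lambda>_. x)" "path_mult X (k' p) (k p) = path_class X (\<lambda>_. p)"
      using p by (auto simp: base_paths_def)
    have "path_component_of Y ?y (\<psi> p)"
      using p pathin_compose[OF _ \<psi>] unfolding path_component_of_def by (metis comp_apply)
    then have mp: "m (\<psi> p) \<in> path_classes Y ?y (\<psi> p)" "m' (\<psi> p) \<in> path_classes Y (\<psi> p) ?y"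
        "path_mult Y (m (\<psi> p)) (m' (\<psi> p)) = path_class Y (\<lambda>_. ?y)"
        "path_mult Y (m' (\<psi> p)) (m (\<psi> p)) = path_class Y (\<lambda>_. \<psi> p)"
      using m by (auto simp: base_paths_def)
    note map_closed = path_map_closed[OF \<psi>]
    have one: "path_map Y \<psi> (path_class X (\<lambda>_. z)) = path_class Y (\<lambda>_. \<psi> z)" if "z \<in> topspace X" for z
      using path_map_class[OF \<psi>, of "\<lambda>_. z"] that by (simp add: pathin_def o_def)
    have pX: "p \<in> topspace X" using path_classes_topspace[OF k(1)] by simp
    have "path_mult Y (m (\<psi> p)) (path_map Y \<psi> (k' p)) \<in> carrier (fundamental_group Y ?y)"
      unfolding carrier_fundamental_group_eq using mp(1) map_closed[OF k(2)] by (rule path_mult_closed)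
    \<comment> \<open>\<open>g\<close> lifts the discrepancy between the prescribed class and the
      image of \<open>k p\<close>; putting it before \<open>k p\<close> yields the lift
      \<open>A\<close>.\<close>
    then obtain g where g: "g \<in> path_classes X x x"
        "path_map Y \<psi> g = path_mult Y (m (\<psi> p)) (path_map Y \<psi> (k' p))"
      using epi fundamental_group_map_eq[OF \<psi>]
      by (auto simp: epi_def carrier_fundamental_group_eq image_iff) (metis imageE)
    define A where "A = path_mult X g (k p)"
    have A: "A \<in> path_classes X x p"
      unfolding A_def using g(1) k(1) by (rule path_mult_closed)
    have "path_map Y \<psi> A = path_mult Y (path_mult Y (m (\<psi> p)) (path_map Y \<psi> (k' p))) (path_map Y \<psi> (k p))"
      unfolding A_def path_map_mult[OF \<psi> g(1) k(1)] g(2) ..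
    also have "\<dots> = path_mult Y (m (\<psi> p)) (path_map Y \<psi> (path_mult X (k' p) (k p)))"
      unfolding path_map_mult[OF \<psi> k(2,1)] using mp(1) map_closed[OF k(2)] map_closed[OF k(1)]
      by (rule path_mult_assoc)
    also have "\<dots> = m (\<psi> p)"
      unfolding k(4) one[OF pX] by (rule path_mult_one(2)[OF mp(1)])
    finally have A_map: "path_map Y \<psi> A = m (\<psi> p)" .
    obtain B where B: "B \<in> path_classes X p x" "path_mult X A B = path_class X (\<lambda>_. x)"
        "path_mult X B A = path_class X (\<lambda>_. p)"
      using path_mult_inverse[OF A] .
    have mB: "path_mult Y (path_map Y \<psi> B) (m (\<psi> p)) = path_class Y (\<lambda>_. \<psi> p)"
      using path_map_mult[OF \<psi> B(1) A] by (simp add: A_map B(3) one[OF pX])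
    \<comment> \<open>The image of \<open>B\<close> is inverse to \<open>m (\<psi> p)\<close>, and
      uniqueness of inverses identifies it with \<open>m' (\<psi> p)\<close>.\<close>
    have "path_map Y \<psi> B = path_mult Y (path_map Y \<psi> B) (path_mult Y (m (\<psi> p)) (m' (\<psi> p)))"
      unfolding mp(3) using path_mult_one(2)[OF map_closed[OF B(1)]] by simp
    also have "\<dots> = m' (\<psi> p)"
      using path_mult_assoc[OF map_closed[OF B(1)] mp(1,2)] path_mult_one(1)[OF mp(2)] by (simp add: mB)
    finally show ?thesis
      using A B A_map by blast
  qed
  then show ?thesis
    unfolding base_paths_def by metis
qed

lemma edge_holonomy_closed:
  assumes "base_paths X x l l'" "x \<in> topspace X" "singular_simplex 1 X \<sigma>"
  shows "edge_holonomy X x l l' \<sigma> \<in> path_classes X x x"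
proof (cases "path_component_of X x (\<sigma> (edge_point 0))")
  case True
  moreover have "path_component_of X x (\<sigma> (edge_point 1))"
    using path_component_of_trans[OF True path_component_of_edge[OF assms(3)]] .
  ultimately have "l (\<sigma> (edge_point 0)) \<in> path_classes X x (\<sigma> (edge_point 0))"
      "l' (\<sigma> (edge_point 1)) \<in> path_classes X (\<sigma> (edge_point 1)) x"
    using assms(1) by (auto simp: base_paths_def)
  from path_mult_closed[OF path_mult_closed[OF this(1) edge_class_in_path_classes[OF assms(3)]] this(2)]
  show ?thesis
    using True by (simp add: edge_holonomy_def)
qed (simp add: edge_holonomy_def path_class_in_path_classes path_between_const assms(2))

text \<open>A triangle lies in one path component. In that of the base point the base paths at the
  middle vertex cancel; elsewhere all three values are trivial.\<close>

lemma edge_holonomy_mult: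
  assumes l: "base_paths X x l l'" and x: "x \<in> topspace X" and \<tau>: "singular_simplex 2 X \<tau>"
  shows "path_mult X (edge_holonomy X x l l' (singular_face 2 2 \<tau>)) (edge_holonomy X x l l' (singular_face 2 0 \<tau>))
    = edge_holonomy X x l l' (singular_face 2 1 \<tau>)"
proof -
  have sf: "singular_simplex 1 X (singular_face 2 i \<tau>)" if "i \<le> 2" for i
    using singular_simplex_singular_face[OF \<tau>, of i] that by simp
  define p where "p = singular_face 2 1 \<tau> (edge_point 0)"
  define q where "q = singular_face 2 0 \<tau> (edge_point 0)"
  define r where "r = singular_face 2 1 \<tau> (edge_point 1)"
  have a: "edge_class X (singular_face 2 2 \<tau>) \<in> path_classes X p q"
    and b: "edge_class X (singular_face 2 0 \<tau>) \<in> path_classes X q r"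
    using edge_class_in_path_classes[OF sf, of 2] edge_class_in_path_classes[OF sf, of 0]
    by (simp_all only: singular_face_2_vertices p_def q_def r_def order_refl zero_le)
  have pq: "path_component_of X p q" and qr: "path_component_of X q r"
    using path_component_of_edge[OF sf, of 2] path_component_of_edge[OF sf, of 0]
    by (simp_all only: singular_face_2_vertices p_def q_def r_def order_refl zero_le)
  show ?thesis
  proof (cases "path_component_of X x p")
    case True
    then have xq: "path_component_of X x q" using pq by (rule path_component_of_trans)
    then have xr: "path_component_of X x r" using qr by (rule path_component_of_trans)
    have "path_mult X (path_mult X (path_mult X (l p) (edge_class X (singular_face 2 2 \<tau>))) (l' q))
        (path_mult X (path_mult X (l q) (edge_class X (singular_face 2 0 \<tau>))) (l' r))
      = path_mult X (path_mult X (l p) (path_mult X (edge_class X (singular_face 2 2 \<tau>)) (edge_class X (singular_face 2 0 \<tau>)))) (l' r)"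
      by (rule path_mult_conj[where y = x]) (use a b l True xq xr in \<open>auto simp: base_paths_def\<close>)
    then show ?thesis
      unfolding edge_class_mult[OF \<tau>] edge_holonomy_def singular_face_2_vertices
      unfolding p_def[symmetric] q_def[symmetric] r_def[symmetric]
      using True xq by simp
  next
    case False
    then have "\<not> path_component_of X x q"
      using pq path_component_of_trans path_component_of_sym by metis
    then show ?thesis
      unfolding edge_holonomy_def singular_face_2_vertices
      unfolding p_def[symmetric] q_def[symmetric] r_def[symmetric]
      using False path_mult_one(1)[OF path_class_in_path_classes[OF path_between_const[OF x]]] by simp
  qed
qed

text \<open>In the component of the base point the base paths correspond under
  \<open>\<psi>\<close>. An edge outside it has its image outside the component of
  \<open>\<psi> x\<close>, by injectivity on H_0, and then both values are the trivial
  default.\<close>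

lemma edge_holonomy_map:
  assumes \<psi>: "integral_homology_equivalence X Y \<psi>" and x: "x \<in> topspace X"
    and l: "base_paths X x l l'"
      "\<And>p. path_component_of X x p \<Longrightarrow> path_map Y \<psi> (l p) = m (\<psi> p)"
      "\<And>p. path_component_of X x p \<Longrightarrow> path_map Y \<psi> (l' p) = m' (\<psi> p)"
    and \<sigma>: "singular_simplex 1 X \<sigma>"
  shows "path_map Y \<psi> (edge_holonomy X x l l' \<sigma>) = edge_holonomy Y (\<psi> x) m m' (simplex_map 1 \<psi> \<sigma>)"
proof -
  have cont: "continuous_map X Y \<psi>"
    using \<psi> by (simp add: integral_homology_equivalence_def)
  let ?p = "\<sigma> (edge_point 0)" and ?q = "\<sigma> (edge_point 1)"
  have ends: "simplex_map 1 \<psi> \<sigma> (edge_point 0) = \<psi> ?p" "simplex_map 1 \<psi> \<sigma> (edge_point 1) = \<psi> ?q"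
    using edge_point_in_simplex[of 0] edge_point_in_simplex[of 1] by (simp_all add: simplex_map_def)
  have pX: "?p \<in> topspace X"
    using path_classes_topspace[OF edge_class_in_path_classes[OF \<sigma>]] by simp
  show ?thesis
  proof (cases "path_component_of X x ?p")
    case True
    then have xq: "path_component_of X x ?q"
      using path_component_of_edge[OF \<sigma>] by (rule path_component_of_trans)
    have "path_component_of Y (\<psi> x) (\<psi> ?p)"
      using True pathin_compose[OF _ cont] unfolding path_component_of_def by (metis comp_apply)
    moreover have lp: "l ?p \<in> path_classes X x ?p" and lq: "l' ?q \<in> path_classes X ?q x"
      using l(1) True xq by (auto simp: base_paths_def)
    ultimately show ?thesis
      unfolding edge_holonomy_def ends
      using True xq by (simp add: l(2,3) path_map_edge_class[OF cont \<sigma>]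
          path_map_mult[OF cont path_mult_closed[OF lp edge_class_in_path_classes[OF \<sigma>]] lq]
          path_map_mult[OF cont lp edge_class_in_path_classes[OF \<sigma>]])
  next
    case False
    then have "\<not> path_component_of Y (\<psi> x) (\<psi> ?p)"
      using integral_homology_equivalence_path_component[OF \<psi> x pX] by blast
    then show ?thesis
      unfolding edge_holonomy_def ends
      using False path_map_class[OF cont, of "\<lambda>_. x"] x by (simp add: pathin_def o_def)
  qed
qed

subsection \<open>The kernel of the induced homomorphism\<close>

theorem proposition3p2:
  fixes X :: "'a topology" and Y :: "'b topology"
    and K :: "'c topology" and L :: "'d topology"
    and \<psi> :: "'a \<Rightarrow> 'b" and x :: 'a
  assumes "connected_space X" and "CW_complex K" and "X homotopy_equivalent_space K"
    and "connected_space Y" and "CW_complex L" and "Y homotopy_equivalent_space L"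
    and "integral_homology_equivalence X Y \<psi>"
    and "x \<in> topspace X"
    and "fundamental_group_map x Y \<psi> \<in> epi (fundamental_group X x) (fundamental_group Y (\<psi> x))"
  shows "kernel (fundamental_group X x) (fundamental_group Y (\<psi> x)) (fundamental_group_map x Y \<psi>)
           \<subseteq> Gamma (fundamental_group X x)"
proof -
  note \<psi> = assms(7) and x = assms(8) and epi = assms(9)
  have cont: "continuous_map X Y \<psi>"
    using \<psi> by (simp add: integral_homology_equivalence_def)
  have y: "\<psi> x \<in> topspace Y"
    using cont x by (auto simp: continuous_map_def)

  \<comment> \<open>The central extension by N / [N, G]\<close>
  define G where "G = fundamental_group X x"
  define Q where "Q = fundamental_group Y (\<psi> x)"
  define f where "f = fundamental_group_map x Y \<psi>"
  interpret G: group G unfolding G_def using x by (rule group_fundamental_group)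
  interpret Q: group Q unfolding Q_def using y by (rule group_fundamental_group)
  have f_epi: "f \<in> epi G Q" using epi by (simp add: f_def G_def Q_def)
  interpret f: group_hom G Q f
    using f_epi by unfold_locales (auto simp: epi_def)
  define N where "N = kernel G Q f"
  have N: "N \<lhd> G" unfolding N_def by (rule f.normal_kernel)
  define C where "C = mixed_commutator G N (carrier G)"
  have C_normal: "C \<lhd> G" unfolding C_def using N by (rule G.mixed_commutator_normal)
  interpret C: normal C G by fact
  have CN: "C \<subseteq> N" unfolding C_def using N by (rule G.mixed_commutator_normal_subset)
  define E where "E = G Mod C"
  have "group E" unfolding E_def by (rule C.factorgroup_is_group)
  \<comment> \<open>As \<open>C\<close> is contained in the kernel \<open>N\<close>, the map
    \<open>f\<close> factors through \<open>E\<close>; the kernel of the factor map is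
    \<open>N\<close> modulo \<open>C\<close>.\<close>
  obtain p where p: "p \<in> hom E Q" "\<And>g. g \<in> carrier G \<Longrightarrow> p (C #>\<^bsub>G\<^esub> g) = f g"
    using f.FactGroup_universal_kernel[OF C_normal CN[unfolded N_def]] unfolding E_def by blast
  have carrE: "e \<in> carrier E \<longleftrightarrow> (\<exists>g\<in>carrier G. e = C #>\<^bsub>G\<^esub> g)" for e
    by (auto simp: E_def FactGroup_def RCOSETS_def)
  have p_epi: "p \<in> epi E Q"
    unfolding epi_def
  proof (intro CollectI conjI equalityI subsetI)
    fix q assume "q \<in> carrier Q"
    then obtain g where "g \<in> carrier G" "q = f g"
      using f_epi by (auto simp: epi_def)
    then show "q \<in> p ` carrier E"
      using p(2) carrE by (metis imageI)
  qed (use p(1) in \<open>auto simp: hom_def\<close>)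
  have central: "a \<otimes>\<^bsub>E\<^esub> e = e \<otimes>\<^bsub>E\<^esub> a" if a: "a \<in> kernel E Q p" and e: "e \<in> carrier E" for a e
  proof -
    obtain g where g: "g \<in> carrier G" "a = C #>\<^bsub>G\<^esub> g" "g \<in> N"
      using a p(2) carrE by (auto simp: kernel_def N_def)
    obtain h where h: "h \<in> carrier G" "e = C #>\<^bsub>G\<^esub> h"
      using e carrE by blast
    show ?thesis
      unfolding E_def g(2) h(2) C_def using N g(3) h(1) by (rule G.FactGroup_mixed_commutator_central)
  qed

  \<comment> \<open>Compatible holonomies on both spaces\<close>
  obtain m m' where m: "base_paths Y (\<psi> x) m m'"
    using base_paths_exists[of Y "\<psi> x"] by blast
  \<comment> \<open>The base paths of \<open>Y\<close> come first, since those of \<open>X\<close>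
    are lifted from them.\<close>
  obtain l l' where l: "base_paths X x l l'"
      "\<And>p. path_component_of X x p \<Longrightarrow> path_map Y \<psi> (l p) = m (\<psi> p)"
      "\<And>p. path_component_of X x p \<Longrightarrow> path_map Y \<psi> (l' p) = m' (\<psi> p)"
    using base_paths_lift[OF cont x epi m] by blast
  define kX where "kX = edge_holonomy X x l l'"
  define kY where "kY = edge_holonomy Y (\<psi> x) m m'"
  have kX: "kX \<sigma> \<in> carrier G" if "singular_simplex 1 X \<sigma>" for \<sigma>
    using edge_holonomy_closed[OF l(1) x that] by (simp add: kX_def G_def carrier_fundamental_group_eq)
  have kY: "kY \<sigma> \<in> carrier Q" if "singular_simplex 1 Y \<sigma>" for \<sigma>
    using edge_holonomy_closed[OF m y that] by (simp add: kY_def Q_def carrier_fundamental_group_eq)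
  have face: "singular_simplex 1 Z (singular_face 2 i \<tau>)" if "singular_simplex 2 Z \<tau>" "i \<le> 2"
    for Z :: "'z topology" and \<tau> i
    using singular_simplex_singular_face[OF that(1), of i] that(2) by simp
  have kX_mult: "kX (singular_face 2 2 \<tau>) \<otimes>\<^bsub>G\<^esub> kX (singular_face 2 0 \<tau>) = kX (singular_face 2 1 \<tau>)"
    if "singular_simplex 2 X \<tau>" for \<tau>
    using edge_holonomy_mult[OF l(1) x that] edge_holonomy_closed[OF l(1) x face[OF that]]
    by (simp add: kX_def G_def mult_fundamental_group_eq)
  have kY_mult: "kY (singular_face 2 2 \<tau>) \<otimes>\<^bsub>Q\<^esub> kY (singular_face 2 0 \<tau>) = kY (singular_face 2 1 \<tau>)"
    if "singular_simplex 2 Y \<tau>" for \<tau>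
    using edge_holonomy_mult[OF m y that] edge_holonomy_closed[OF m y face[OF that]]
    by (simp add: kY_def Q_def mult_fundamental_group_eq)
  have kX_map: "f (kX \<sigma>) = kY (simplex_map 1 \<psi> \<sigma>)" if "singular_simplex 1 X \<sigma>" for \<sigma>
    using edge_holonomy_map[OF \<psi> x l that] fundamental_group_map_eq[OF cont edge_holonomy_closed[OF l(1) x that]]
    by (simp add: kX_def kY_def f_def)

  \<comment> \<open>Vanishing of kernel classes in the extension\<close>
  have "N \<subseteq> C"
  proof
    fix A assume A: "A \<in> N"
    then have AG: "A \<in> carrier G" and fA: "f A = \<one>\<^bsub>Q\<^esub>"
      by (simp_all add: N_def kernel_def)
    then obtain \<gamma> where \<gamma>: "path_between X x x \<gamma>" "A = path_class X \<gamma>"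
      by (auto simp: G_def carrier_fundamental_group_eq path_classes_def)
    then have \<gamma>': "pathin X \<gamma>" "\<gamma> 0 = x" "\<gamma> 1 = x" by (simp_all add: path_between_def)
    have "path_class Y (\<psi> \<circ> \<gamma>) = path_class Y (\<lambda>_. \<psi> x)"
      using fA path_map_class[OF cont \<gamma>'(1)] fundamental_group_map_eq[OF cont, of A x] AG
      by (simp add: f_def Q_def G_def \<gamma>(2) one_fundamental_group_eq[OF y] carrier_fundamental_group_eq)
    then have null: "path_homotopic Y (\<psi> \<circ> \<gamma>) (\<lambda>_. \<psi> x)"
      using pathin_compose[OF \<gamma>'(1) cont] by (rule path_class_eqD)
    obtain D where D: "singular_simplex 2 Y D" "singular_face 2 2 D = simplex_of_path (\<psi> \<circ> \<gamma>)"
        "singular_face 2 0 D = singular_face 2 1 D"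
      using cone_simplex_exists[OF null] \<gamma>' by auto
    define \<sigma> where "\<sigma> = simplex_of_path \<gamma>"
    have \<sigma>: "singular_simplex 1 X \<sigma>"
      unfolding \<sigma>_def using \<gamma>'(1) by (rule singular_simplex_of_path)
    have ends: "\<sigma> (edge_point 0) = x" "\<sigma> (edge_point 1) = x"
      using \<gamma>' by (simp_all add: \<sigma>_def simplex_of_path_edge_point)
    \<comment> \<open>Edges of \<open>X\<close> are labelled by the cosets of their holonomy modulo
      \<open>C\<close>, edges of \<open>Y\<close> by their holonomy in \<open>Q\<close>; the
      null-homotopy supplies the disc \<open>D\<close>.\<close>
    have "C #>\<^bsub>G\<^esub> kX \<sigma> = \<one>\<^bsub>E\<^esub>"
    proof (rule central_extension_boundary_trivial[OF \<open>group E\<close> Q.is_group p_epi central \<psi>,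
          where k = "\<lambda>\<sigma>. C #>\<^bsub>G\<^esub> kX \<sigma>" and m = kY])
      show "singular_face 1 0 \<sigma> = singular_face 1 1 \<sigma>"
      proof
        fix a show "singular_face 1 0 \<sigma> a = singular_face 1 1 \<sigma> a"
          using singular_face_1_edge_point[of \<sigma>] ends
          by (cases "a = edge_point 0") (simp_all add: singular_face_def edge_point_0)
      qed
      show "singular_face 2 2 D = simplex_map 1 \<psi> \<sigma>"
        unfolding \<sigma>_def simplex_map_simplex_of_path by (rule D(2))
      fix \<tau> assume \<tau>: "singular_simplex 2 X \<tau>"
      show "(C #>\<^bsub>G\<^esub> kX (singular_face 2 2 \<tau>)) \<otimes>\<^bsub>E\<^esub> (C #>\<^bsub>G\<^esub> kX (singular_face 2 0 \<tau>))
          = C #>\<^bsub>G\<^esub> kX (singular_face 2 1 \<tau>)"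
        using kX[OF face[OF \<tau>]] kX_mult[OF \<tau>] by (simp add: E_def FactGroup_def C.rcos_sum)
    qed (use carrE kX kY kY_mult kX_map p(2) \<sigma> D in auto)
    then have "kX \<sigma> \<in> C"
      using G.rcos_self[OF kX[OF \<sigma>] C.subgroup_axioms] by (simp add: E_def FactGroup_def)
    have xx: "path_component_of X x x" using x by (simp add: path_component_of_refl)
    then have lx: "l x \<in> carrier G" "l' x \<in> carrier G" "l x \<otimes>\<^bsub>G\<^esub> l' x = \<one>\<^bsub>G\<^esub>"
      using l(1) by (auto simp: base_paths_def G_def carrier_fundamental_group_eq
          mult_fundamental_group_eq one_fundamental_group_eq[OF x])
    then have l'x: "l' x = inv\<^bsub>G\<^esub> l x"
      using G.inv_equality G.r_inv by (metis G.inv_unique')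
    \<comment> \<open>The base path at \<open>x\<close> may be a nontrivial loop, so the holonomy is
      a conjugate of \<open>A\<close>; normality of \<open>C\<close> absorbs the
      conjugation.\<close>
    have "kX \<sigma> = l x \<otimes>\<^bsub>G\<^esub> A \<otimes>\<^bsub>G\<^esub> inv\<^bsub>G\<^esub> l x"
      using lx AG \<gamma>' xx G.m_closed[OF lx(1) AG]
      unfolding l'x[symmetric] kX_def edge_holonomy_def ends
      by (simp add: \<sigma>_def edge_class_simplex_of_path G_def carrier_fundamental_group_eq
          mult_fundamental_group_eq flip: \<gamma>(2))
    then have "inv\<^bsub>G\<^esub> l x \<otimes>\<^bsub>G\<^esub> kX \<sigma> \<otimes>\<^bsub>G\<^esub> l x
        = (inv\<^bsub>G\<^esub> l x \<otimes>\<^bsub>G\<^esub> l x) \<otimes>\<^bsub>G\<^esub> A \<otimes>\<^bsub>G\<^esub> (inv\<^bsub>G\<^esub> l x \<otimes>\<^bsub>G\<^esub> l x)"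
      using lx(1) AG by (simp only: G.m_assoc G.m_closed G.inv_closed)
    then have "A = inv\<^bsub>G\<^esub> l x \<otimes>\<^bsub>G\<^esub> kX \<sigma> \<otimes>\<^bsub>G\<^esub> l x"
      using lx(1) AG by simp
    then show "A \<in> C"
      using C.inv_op_closed1[OF lx(1) \<open>kX \<sigma> \<in> C\<close>] by simp
  qed
  \<comment> \<open>The two inclusions give \<open>N = [N, G]\<close>, and \<open>Gamma G\<close>
    contains every such normal subgroup.\<close>
  with CN have "relatively_perfect G N"
    using N by (auto simp: relatively_perfect_def C_def)
  then show ?thesis
    using G.Gamma_greatest(2) by (simp add: N_def G_def Q_def f_def)
qed

end
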